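(* The following two decision problems are not algorithmically solvable (i.e. they are undecidable): (UW) given a dynamical system with double recursion $\mathfrak{A} = (A, f, 0, 1)$, tell whether $\mathfrak{A}$ is ultimately zero; (SUW) given a symmetric dynamical system with double recursion $\mathfrak{S} = (S, f, 0, 1)$, tell whether $\mathfrak{S}$ is ultimately zero.
   Context: A dynamical system with double recursion is a tuple $\mathfrak{A} = (A, f, 0, 1)$ consisting of a finite set $A$, a function $f : A \times A \to A$, an element $1 \in A$ called the start symbol, and an element $0 \in A$ called the white colour. It is symmetric if $f(x,y) = f(y,x)$ for all $x, y \in A$. Instances are given as finite data (e.g. $A = \{0,\dots,n-1\}$, a table of values of $f$, and the two distinguished elements). The development of $\mathfrak{A}$ is the function $a : \mathbb{N} \times \mathbb{N} \to A$ (with $0 \in \mathbb{N}$) defined by $a(i,j) = 1$ if $i = 0$ or $j = 0$, and $a(i,j) = f(a(i-1,j), a(i,j-1))$ if $i > 0$ and $j > 0$. $\mathfrak{A}$ is called ultimately zero if there exists $N \in \mathbb{N}$ such that for all $i, j \in \mathbb{N}$ with $i > 0$, $j > 0$ and $i + j > N$ one has $a(i,j) = 0$. *)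

theory Defs
  imports Main "HOL-Library.Nat_Bijection"
begin

section \<open>Dynamical systems with double recursion\<close>

text \<open>The map \<open>rule\<close> is a total HOL function; only its values on \<open>states \<times> states\<close> matter.
  As in the definition of a tuple \<open>(A, f, 0, 1)\<close>, nothing forces \<open>white \<noteq> start\<close>.\<close>

record 'a drs =
  states :: "'a set"
  rule :: "'a \<Rightarrow> 'a \<Rightarrow> 'a"
  white :: 'a
  start :: 'a

definition is_drs :: "'a drs \<Rightarrow> bool" where
  "is_drs D \<longleftrightarrow> finite (states D) \<and>
     (\<forall>x\<in>states D. \<forall>y\<in>states D. rule D x y \<in> states D) \<and>
     white D \<in> states D \<and> start D \<in> states D"

definition symmetric_drs :: "'a drs \<Rightarrow> bool" where
  "symmetric_drs D \<longleftrightarrow> (\<forall>x\<in>states D. \<forall>y\<in>states D. rule D x y = rule D y x)"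

fun development :: "'a drs \<Rightarrow> nat \<Rightarrow> nat \<Rightarrow> 'a" where
  "development D 0 j = start D"
| "development D (Suc i) 0 = start D"
| "development D (Suc i) (Suc j) = rule D (development D i (Suc j)) (development D (Suc i) j)"

definition ultimately_zero :: "'a drs \<Rightarrow> bool" where
  "ultimately_zero D \<longleftrightarrow>
     (\<exists>N. \<forall>i j. i > 0 \<and> j > 0 \<and> i + j > N \<longrightarrow> development D i j = white D)"


section \<open>Finite data\<close>

text \<open>The instances of the decision problems are the systems on \<open>{0, \<dots>, n - 1}\<close>; the white colour
  and the start symbol may be any two of these numbers.\<close>

definition drs_instances :: "nat drs set" where
  "drs_instances = {D. is_drs D \<and> (\<exists>n. states D = {..<n})}"

text \<open>The finite data are \<open>n\<close>, the white colour, the start symbol and the table of the rule in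
  row-major order, packed into one number by the library's computable bijection between lists of
  naturals and naturals. Two instances with the same code differ at most in the values of
  \<open>rule\<close> outside \<open>states\<close> (lemma \<open>drs_code_eqD\<close>).\<close>

definition drs_code :: "nat drs \<Rightarrow> nat" where
  "drs_code D = (let n = card (states D) in
     list_encode (n # white D # start D # [rule D x y. x \<leftarrow> [0..<n], y \<leftarrow> [0..<n]]))"

lemma drs_code_eqD:
  assumes "D \<in> drs_instances" "E \<in> drs_instances" "drs_code D = drs_code E"
  shows "states D = states E" "white D = white E" "start D = start E"
    "\<forall>x\<in>states D. \<forall>y\<in>states D. rule D x y = rule E x y"
proof -
  obtain m n where m: "states D = {..<m}" and n: "states E = {..<n}"
    using assms by (auto simp: drs_instances_def)
  have eq: "m # white D # start D # [rule D x y. x \<leftarrow> [0..<m], y \<leftarrow> [0..<m]]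
      = n # white E # start E # [rule E x y. x \<leftarrow> [0..<n], y \<leftarrow> [0..<n]]"
    using assms(3) m n by (auto simp: drs_code_def list_encode_eq)
  then have mn: "m = n" by simp
  then show "states D = states E" "white D = white E" "start D = start E"
    using m n eq by auto
  have agree: "\<forall>x\<in>set xs. \<forall>y\<in>set ys. f x y = g x y"
    if "concat (map (\<lambda>x. map (f x) ys) xs) = concat (map (\<lambda>x. map (g x) ys) xs)"
    for f g :: "nat \<Rightarrow> nat \<Rightarrow> nat" and xs ys
    using that by (induction xs) auto
  show "\<forall>x\<in>states D. \<forall>y\<in>states D. rule D x y = rule E x y"
    using agree[of "rule D" "[0..<m]" "[0..<m]" "rule E"] eq mn m by auto
qed


section \<open>Algorithms\<close>

text \<open>Algorithms are Kleene's partial recursive functions, given by programs with a big-step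
  evaluation relation. Arities are not part of the syntax: a program \<open>p\<close> denotes, for every \<open>k\<close>, the
  \<open>k\<close>-ary partial recursive function with graph \<open>{(xs, y). length xs = k \<and> recf_eval p xs y}\<close>; on
  argument lists of an unsuitable length it is undefined. The recursion variable and the variable
  being minimised come first. Divergence is the absence of a value; in particular \<open>Mu p\<close>
  requires all values of \<open>p\<close> before the first zero to be defined.\<close>

datatype recf =
  Zero
| Succ
| Proj nat
| Comp recf "recf list"
| PrimRec recf recf
| Mu recf

inductive recf_eval :: "recf \<Rightarrow> nat list \<Rightarrow> nat \<Rightarrow> bool" where
  Zero: "recf_eval Zero xs 0"
| Succ: "recf_eval Succ [x] (Suc x)"
| Proj: "i < length xs \<Longrightarrow> recf_eval (Proj i) xs (xs ! i)"
| Comp: "list_all2 (\<lambda>g y. recf_eval g xs y) gs ys \<Longrightarrow> recf_eval f ys z \<Longrightarrow>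
    recf_eval (Comp f gs) xs z"
| PrimRec_0: "recf_eval f xs z \<Longrightarrow> recf_eval (PrimRec f g) (0 # xs) z"
| PrimRec_Suc: "recf_eval (PrimRec f g) (n # xs) y \<Longrightarrow> recf_eval g (n # y # xs) z \<Longrightarrow>
    recf_eval (PrimRec f g) (Suc n # xs) z"
| Mu: "recf_eval f (n # xs) 0 \<Longrightarrow> (\<And>m. m < n \<Longrightarrow> \<exists>y. recf_eval f (m # xs) (Suc y)) \<Longrightarrow>
    recf_eval (Mu f) xs n"

inductive_cases recf_evalE:
  "recf_eval Zero xs z" "recf_eval Succ xs z" "recf_eval (Proj i) xs z"
  "recf_eval (Comp f gs) xs z" "recf_eval (PrimRec f g) (0 # xs) z"
  "recf_eval (PrimRec f g) (Suc n # xs) z" "recf_eval (Mu f) xs z"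

lemma recf_eval_deterministic: "recf_eval p xs y \<Longrightarrow> recf_eval p xs z \<Longrightarrow> y = z"
proof (induction arbitrary: z rule: recf_eval.induct)
  case (Comp xs gs ys f w)
  from Comp.prems obtain ys' where
    ys': "list_all2 (\<lambda>g y. recf_eval g xs y) gs ys'" "recf_eval f ys' z"
    by (rule recf_evalE)
  have "ys = ys'"
    using Comp.IH(1) ys'(1) by (auto simp: list_all2_conv_all_nth intro!: nth_equalityI)
  then show ?case using Comp.IH(2) ys'(2) by blast
next
  case (PrimRec_Suc f g n xs y w)
  from PrimRec_Suc.prems obtain y' where
    "recf_eval (PrimRec f g) (n # xs) y'" "recf_eval g (n # y' # xs) z"
    by (rule recf_evalE)
  then show ?case using PrimRec_Suc.IH by blast
next
  case (Mu f n xs)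
  from Mu.prems have z: "recf_eval f (z # xs) 0" "\<And>m. m < z \<Longrightarrow> \<exists>y. recf_eval f (m # xs) (Suc y)"
    by (blast elim: recf_evalE(7))+
  have "\<not> n < z" using Mu.IH(1) z(2) by blast
  moreover have "\<not> z < n" using Mu.IH(2) z(1) by blast
  ultimately show ?case by simp
next
  case PrimRec_0
  then show ?case by (blast elim: recf_evalE(5))
qed (auto elim: recf_evalE(1-3))

text \<open>An algorithm for a decision problem has to halt on the codes of all instances, answering 1 for
  yes and 0 for no; what it does on other numbers is irrelevant.\<close>

definition algorithmically_solvable :: "('i \<Rightarrow> nat) \<Rightarrow> 'i set \<Rightarrow> ('i \<Rightarrow> bool) \<Rightarrow> bool" where
  "algorithmically_solvable code instances Q \<longleftrightarrow>
     (\<exists>p. \<forall>x\<in>instances. recf_eval p [code x] (if Q x then 1 else 0))"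

end

theory Submission imports Defs begin

text \<open>A decision algorithm for the symmetric systems would be a program, and every program can be
  simulated by a symmetric system: each row of the development shows a configuration of a counter
  machine, read off the diagonal outwards, and when the machine halts a killing state spreads and
  dies out at the boundary of the live region. So the development is ultimately zero iff the machine
  halts. The input \<open>c\<close> is supplied by a chain of \<open>c\<close> additional states along the first row, and the
  code of the system with input \<open>c\<close> is a computable function of \<open>c\<close> and the table of the system
  without input. The contradiction comes from the program that halts on \<open>c\<close> iff the system with
  table \<open>c\<close> and input \<open>c\<close> is not ultimately zero, applied to the table of its own system; neither
  a universal program nor the computability of the compilation is needed.\<close>

section \<open>Counter programs\<close>

datatype com = Skip | Inc nat | Dec nat | Seq com com | While nat com

text \<open>The store enters only through the set \<open>P\<close> of nonzero registers, because
  this set is what a diagonal cell reads off its neighbours. The empty stack is the halted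
  state.\<close>

fun next_stack :: "com list \<Rightarrow> nat set \<Rightarrow> com list" where
  "next_stack (Seq a b # K) P = a # b # K"
| "next_stack (While r a # K) P = (if r \<in> P then a # While r a # K else K)"
| "next_stack (_ # K) P = K"
| "next_stack [] P = []"

fun next_store :: "com list \<Rightarrow> (nat \<Rightarrow> nat) \<Rightarrow> nat \<Rightarrow> nat" where
  "next_store (Inc r # K) s = s(r := Suc (s r))"
| "next_store (Dec r # K) s = s(r := s r - 1)"
| "next_store _ s = s"

definition step :: "com list \<times> (nat \<Rightarrow> nat) \<Rightarrow> com list \<times> (nat \<Rightarrow> nat)" where
  "step cfg = (next_stack (fst cfg) {r. 0 < snd cfg r}, next_store (fst cfg) (snd cfg))"

text \<open>Ranging over every continuation \<open>K\<close> makes runs composable: a finished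
  command uncovers exactly the stack below it.\<close>

definition exec :: "com \<Rightarrow> (nat \<Rightarrow> nat) \<Rightarrow> (nat \<Rightarrow> nat) \<Rightarrow> bool" where
  "exec c s s' \<longleftrightarrow> (\<forall>K. \<exists>t. (step ^^ t) (c # K, s) = (K, s'))"

lemma exec_1: "(\<And>K. step (c # K, s) = (K, s')) \<Longrightarrow> exec c s s'"
  unfolding exec_def by (metis funpow_0 funpow_simps_right(2) comp_apply)

lemma exec_Skip: "exec Skip s s"
  and exec_Inc: "exec (Inc r) s (s(r := Suc (s r)))"
  and exec_Dec: "exec (Dec r) s (s(r := s r - 1))"
  and exec_While_0: "s r = 0 \<Longrightarrow> exec (While r c) s s"
  by (auto intro!: exec_1 simp: step_def)

lemma exec_Seq:
  assumes "exec a s s1" "exec b s1 s2"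
  shows "exec (Seq a b) s s2"
  unfolding exec_def
proof
  fix K
  obtain t where t: "(step ^^ t) (a # b # K, s) = (b # K, s1)"
    using assms(1) by (auto simp: exec_def)
  obtain u where u: "(step ^^ u) (b # K, s1) = (K, s2)"
    using assms(2) by (auto simp: exec_def)
  have "(step ^^ (u + t + 1)) (Seq a b # K, s) = (step ^^ u) ((step ^^ t) (step (Seq a b # K, s)))"
    by (simp add: funpow_add funpow_swap1)
  also have "\<dots> = (K, s2)"
    by (simp add: step_def t u)
  finally show "\<exists>t. (step ^^ t) (Seq a b # K, s) = (K, s2)" by blast
qed

lemma exec_While_step:
  assumes "s r \<noteq> 0" "exec c s s1" "exec (While r c) s1 s2"
  shows "exec (While r c) s s2"
  unfolding exec_def
proof
  fix K
  obtain t where t: "(step ^^ t) (c # While r c # K, s) = (While r c # K, s1)"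
    using assms(2) by (auto simp: exec_def)
  obtain u where u: "(step ^^ u) (While r c # K, s1) = (K, s2)"
    using assms(3) by (auto simp: exec_def)
  have "(step ^^ (u + t + 1)) (While r c # K, s)
      = (step ^^ u) ((step ^^ t) (step (While r c # K, s)))"
    by (simp add: funpow_add funpow_swap1)
  also have "\<dots> = (K, s2)"
    using assms(1) by (simp add: step_def t u)
  finally show "\<exists>t. (step ^^ t) (While r c # K, s) = (K, s2)" by blast
qed

section \<open>Clearing and copying registers\<close>

definition clear :: "nat \<Rightarrow> com" where
  "clear r = While r (Dec r)"

lemma exec_clear: "exec (clear r) s (s(r := 0))"
proof (induction "s r" arbitrary: s)
  case 0
  then have "s(r := 0) = s" by auto
  then show ?case using 0 exec_While_0 by (simp add: clear_def)
next
  case (Suc v)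
  from Suc(1)[of "s(r := v)"] have "exec (clear r) (s(r := v)) (s(r := 0))" by simp
  moreover have "exec (Dec r) s (s(r := v))"
    using exec_Dec[of r s] Suc(2) by (metis diff_Suc_1)
  ultimately show ?case
    using exec_While_step Suc(2) unfolding clear_def by (metis Zero_not_Suc)
qed

definition copy :: "nat \<Rightarrow> nat \<Rightarrow> nat \<Rightarrow> com" where
  "copy a d t = Seq (clear d) (Seq (While a (Seq (Dec a) (Seq (Inc d) (Inc t))))
     (While t (Seq (Dec t) (Inc a))))"

lemma exec_copy:
  assumes "a \<noteq> d" "a \<noteq> t" "d \<noteq> t" "s t = 0"
  shows "exec (copy a d t) s (s(d := s a))"
proof -
  have 1: "exec (While a (Seq (Dec a) (Seq (Inc d) (Inc t)))) s
      (s(a := 0, d := s d + s a, t := s t + s a))" for s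
  proof (induction "s a" arbitrary: s)
    case 0
    then have eq: "s(a := 0, d := s d + s a, t := s t + s a) = s" by auto
    show ?case unfolding eq using 0 by (intro exec_While_0) simp
  next
    case (Suc v)
    let ?s = "s(a := s a - 1, d := Suc (s d), t := Suc (s t))"
    have "exec (Seq (Dec a) (Seq (Inc d) (Inc t))) s ?s"
      using exec_Seq[OF exec_Dec[of a s] exec_Seq[OF exec_Inc[of d] exec_Inc[of t]]] assms
      by simp
    moreover have "?s(a := 0, d := ?s d + ?s a, t := ?s t + ?s a)
        = s(a := 0, d := s d + s a, t := s t + s a)"
      using Suc(2) assms by (auto simp: fun_eq_iff)
    moreover have "v = ?s a" using Suc(2) assms by auto
    ultimately show ?case
      using exec_While_step Suc(1)[of ?s] Suc(2) by (metis Zero_not_Suc)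
  qed
  have 2: "exec (While t (Seq (Dec t) (Inc a))) s (s(t := 0, a := s a + s t))" for s
  proof (induction "s t" arbitrary: s)
    case 0
    then have eq: "s(t := 0, a := s a + s t) = s" by auto
    show ?case unfolding eq using 0 by (intro exec_While_0) simp
  next
    case (Suc v)
    let ?s = "s(t := s t - 1, a := Suc (s a))"
    have "exec (Seq (Dec t) (Inc a)) s ?s"
      using exec_Seq[OF exec_Dec[of t s] exec_Inc[of a]] assms by simp
    moreover have "?s(t := 0, a := ?s a + ?s t) = s(t := 0, a := s a + s t)"
      using Suc(2) assms by (auto simp: fun_eq_iff)
    moreover have "v = ?s t" using Suc(2) assms by auto
    ultimately show ?case
      using exec_While_step Suc(1)[of ?s] Suc(2) by (metis Zero_not_Suc)
  qed
  let ?s1 = "s(d := 0)"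
  let ?s2 = "?s1(a := 0, d := ?s1 d + ?s1 a, t := ?s1 t + ?s1 a)"
  have "?s2(t := 0, a := ?s2 a + ?s2 t) = s(d := s a)"
    using assms by (auto simp: fun_eq_iff)
  then show ?thesis
    unfolding copy_def using exec_Seq[OF exec_clear[of d s] exec_Seq[OF 1 2]] by simp
qed

lemma clear_range: "\<exists>c. \<forall>s. exec c s (\<lambda>r. if n \<le> r \<and> r < n + k then 0 else s r)"
proof (induction k)
  case 0
  have "(\<lambda>r. if n \<le> r \<and> r < n + 0 then 0 else s r) = s" for s :: "nat \<Rightarrow> nat" by auto
  then show ?case using exec_Skip by metis
next
  case (Suc k)
  then obtain c where c: "\<And>s. exec c s (\<lambda>r. if n \<le> r \<and> r < n + k then 0 else s r)" by blast
  have "exec (Seq c (clear (n + k))) s (\<lambda>r. if n \<le> r \<and> r < n + Suc k then 0 else s r)" for s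
  proof -
    have eq: "(\<lambda>r. if n \<le> r \<and> r < n + Suc k then 0 else s r)
        = (\<lambda>r. if n \<le> r \<and> r < n + k then 0 else s r)(n + k := 0)"
      by (auto simp: fun_eq_iff)
    show ?thesis unfolding eq by (rule exec_Seq[OF c exec_clear])
  qed
  then show ?case by blast
qed

section \<open>Compilation of partial recursive functions into counter programs\<close>

text \<open>The program reads its arguments from the registers \<open>as\<close>, may use the registers from \<open>n\<close> on as
  scratch space, and leaves no trace besides the result.\<close>

definition implements :: "recf \<Rightarrow> com \<Rightarrow> nat list \<Rightarrow> nat \<Rightarrow> nat \<Rightarrow> bool" where
  "implements p c as d n \<longleftrightarrow> (\<forall>y s. recf_eval p (map s as) y \<longrightarrow> (\<forall>r\<ge>n. s r = 0) \<longrightarrow>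
     exec c s (s(d := y)))"

text \<open>All register layouts are covered at once, so that the induction on \<open>p\<close> can
  place arguments and results of subprograms in fresh registers from \<open>n\<close> on.\<close>

definition implementable :: "recf \<Rightarrow> bool" where
  "implementable p \<longleftrightarrow> (\<forall>as d n. set as \<subseteq> {..<n} \<longrightarrow> d < n \<longrightarrow> d \<notin> set as \<longrightarrow>
     (\<exists>c. implements p c as d n))"

lemma implementableD:
  assumes "implementable p" "set as \<subseteq> {..<n}" "d < n" "d \<notin> set as"
  obtains c where
    "\<And>y s. recf_eval p (map s as) y \<Longrightarrow> \<forall>r\<ge>n. s r = 0 \<Longrightarrow> exec c s (s(d := y))"
  using assms unfolding implementable_def implements_def by blast

text \<open>The arguments lie below \<open>n <= j\<close>, so storing one value leaves them intact
  for the next program; scratch space starts at \<open>N\<close>, beyond all stored values.\<close>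

lemma implement_list:
  assumes "\<forall>g\<in>set gs. implementable g" "set as \<subseteq> {..<n}" "n \<le> j" "j + length gs \<le> N"
  shows "\<exists>c. \<forall>ys s. list_all2 (\<lambda>g y. recf_eval g (map s as) y) gs ys \<longrightarrow> (\<forall>r\<ge>N. s r = 0) \<longrightarrow>
    exec c s (\<lambda>r. if j \<le> r \<and> r < j + length gs then ys ! (r - j) else s r)"
  using assms
proof (induction gs arbitrary: j)
  case Nil
  have "(\<lambda>r. if j \<le> r \<and> r < j + length [] then ys ! (r - j) else s r) = s" for ys and s :: "nat \<Rightarrow> nat"
    by auto
  then show ?case using exec_Skip by metis
next
  case (Cons g gs)
  have "implementable g" "set as \<subseteq> {..<N}" "j < N" "j \<notin> set as"
    using Cons.prems by auto
  then obtain c where c: "\<And>y s. recf_eval g (map s as) y \<Longrightarrow> \<forall>r\<ge>N. s r = 0 \<Longrightarrow>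
      exec c s (s(j := y))"
    by (rule implementableD) blast
  obtain c' where c': "\<And>ys s. list_all2 (\<lambda>g y. recf_eval g (map s as) y) gs ys \<Longrightarrow>
      \<forall>r\<ge>N. s r = 0 \<Longrightarrow>
      exec c' s (\<lambda>r. if Suc j \<le> r \<and> r < Suc j + length gs then ys ! (r - Suc j) else s r)"
    using Cons.IH[of "Suc j"] Cons.prems by auto
  have "exec (Seq c c') s (\<lambda>r. if j \<le> r \<and> r < j + length (g # gs) then ys ! (r - j) else s r)"
    if ys: "list_all2 (\<lambda>g y. recf_eval g (map s as) y) (g # gs) ys" and 0: "\<forall>r\<ge>N. s r = 0" for ys s
  proof -
    obtain z zs where z: "ys = z # zs" "recf_eval g (map s as) z"
      "list_all2 (\<lambda>g y. recf_eval g (map s as) y) gs zs"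
      using ys by (auto simp: list_all2_Cons1)
    have m: "map (s(j := z)) as = map s as"
      using \<open>j \<notin> set as\<close> by auto
    have e1: "exec c s (s(j := z))" using c z(2) 0 by blast
    have e2: "exec c' (s(j := z))
      (\<lambda>r. if Suc j \<le> r \<and> r < Suc j + length gs then zs ! (r - Suc j) else (s(j := z)) r)"
      by (rule c', unfold m) (use z(3) 0 \<open>j < N\<close> in auto)
    have eq: "(\<lambda>r. if Suc j \<le> r \<and> r < Suc j + length gs then zs ! (r - Suc j) else (s(j := z)) r)
       = (\<lambda>r. if j \<le> r \<and> r < j + length (g # gs) then ys ! (r - j) else s r)" (is "?l = ?r")
    proof
      fix r
      have "r - j = Suc (r - Suc j)" if "j < r" using that by simp
      then show "?l r = ?r r" using z(1) by (cases r j rule: linorder_cases) auto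
    qed
    show ?thesis using exec_Seq[OF e1 e2] unfolding eq .
  qed
  then show ?case by blast
qed

lemma implementable_Zero: "implementable Zero"
  using exec_clear by (fastforce simp: implementable_def implements_def elim: recf_evalE)

lemma implementable_Succ: "implementable Succ"
  unfolding implementable_def
proof (intro allI impI)
  fix as :: "nat list" and d n :: nat assume *: "set as \<subseteq> {..<n}" "d < n" "d \<notin> set as"
  show "\<exists>c. implements Succ c as d n"
  proof (intro exI)
    show "implements Succ (Seq (copy (hd as) d n) (Inc d)) as d n"
      unfolding implements_def
    proof (intro allI impI)
      fix y s assume ev: "recf_eval Succ (map s as) y" and 0: "\<forall>r\<ge>n. s r = 0"
      from ev obtain a where a: "as = [a]" "y = Suc (s a)" by (auto elim!: recf_evalE)
      have "exec (copy a d n) s (s(d := s a))"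
        by (rule exec_copy) (use * a 0 in auto)
      from exec_Seq[OF this exec_Inc, of d]
      show "exec (Seq (copy (hd as) d n) (Inc d)) s (s(d := y))" using a by simp
    qed
  qed
qed

lemma implementable_Proj: "implementable (Proj i)"
  unfolding implementable_def
proof (intro allI impI)
  fix as :: "nat list" and d n :: nat assume *: "set as \<subseteq> {..<n}" "d < n" "d \<notin> set as"
  show "\<exists>c. implements (Proj i) c as d n"
  proof (intro exI)
    show "implements (Proj i) (copy (as ! i) d n) as d n"
      unfolding implements_def
    proof (intro allI impI)
      fix y s assume ev: "recf_eval (Proj i) (map s as) y" and 0: "\<forall>r\<ge>n. s r = 0"
      from ev have a: "i < length as" "y = s (as ! i)" by (auto elim!: recf_evalE)
      then have "as ! i \<in> set as" by simp
      then show "exec (copy (as ! i) d n) s (s(d := y))"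
        using a exec_copy[of "as ! i" d n s] * 0 by fastforce
    qed
  qed
qed

lemma implementable_Comp:
  assumes "implementable f" "\<forall>g\<in>set gs. implementable g"
  shows "implementable (Comp f gs)"
  unfolding implementable_def
proof (intro allI impI)
  fix as :: "nat list" and d n :: nat assume *: "set as \<subseteq> {..<n}" "d < n" "d \<notin> set as"
  let ?N = "n + length gs"
  obtain c1 where c1: "\<And>ys s. list_all2 (\<lambda>g y. recf_eval g (map s as) y) gs ys \<Longrightarrow>
      \<forall>r\<ge>?N. s r = 0 \<Longrightarrow>
      exec c1 s (\<lambda>r. if n \<le> r \<and> r < n + length gs then ys ! (r - n) else s r)"
    using implement_list[OF assms(2) *(1), of n ?N] by auto
  have "set [n..<?N] \<subseteq> {..<?N}" "d < ?N" "d \<notin> set [n..<?N]" using *(2) by auto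
  from implementableD[OF assms(1) this]
  obtain c2 where c2: "\<And>y s. recf_eval f (map s [n..<?N]) y \<Longrightarrow> \<forall>r\<ge>?N. s r = 0 \<Longrightarrow>
      exec c2 s (s(d := y))"
    by blast
  \<comment> \<open>Only the result in \<open>d\<close> may remain, so the intermediate values are
    erased at the end.\<close>
  obtain c3 where c3: "\<And>s. exec c3 s (\<lambda>r. if n \<le> r \<and> r < ?N then 0 else s r)"
    using clear_range by blast
  have "implements (Comp f gs) (Seq c1 (Seq c2 c3)) as d n"
    unfolding implements_def
  proof (intro allI impI)
    fix y s assume ev: "recf_eval (Comp f gs) (map s as) y" and 0: "\<forall>r\<ge>n. s r = 0"
    from ev obtain ys where ys: "list_all2 (\<lambda>g y. recf_eval g (map s as) y) gs ys" "recf_eval f ys y"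
      by (rule recf_evalE)
    let ?s1 = "\<lambda>r. if n \<le> r \<and> r < ?N then ys ! (r - n) else s r"
    have 1: "exec c1 s ?s1" using c1[OF ys(1)] 0 by auto
    have len: "length ys = length gs" using ys(1) by (simp add: list_all2_lengthD)
    have m: "map ?s1 [n..<?N] = ys"
      by (rule nth_equalityI) (auto simp: len)
    have 2: "exec c2 ?s1 (?s1(d := y))"
      by (rule c2) (use 0 ys(2) in \<open>simp_all only: m, auto\<close>)
    have "(\<lambda>r. if n \<le> r \<and> r < ?N then 0 else (?s1(d := y)) r) = s(d := y)"
      using 0 *(2) by (auto simp: fun_eq_iff)
    with c3[of "?s1(d := y)"] have "exec c3 (?s1(d := y)) (s(d := y))" by simp
    then show "exec (Seq c1 (Seq c2 c3)) s (s(d := y))"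
      using exec_Seq 1 2 by blast
  qed
  then show "\<exists>c. implements (Comp f gs) c as d n" by blast
qed

lemma implementable_PrimRec:
  assumes "implementable f" "implementable g"
  shows "implementable (PrimRec f g)"
  unfolding implementable_def
proof (intro allI impI)
  fix as :: "nat list" and d n :: nat assume *: "set as \<subseteq> {..<n}" "d < n" "d \<notin> set as"
  show "\<exists>c. implements (PrimRec f g) c as d n"
  proof (cases as)
    case Nil
    have "\<not> recf_eval (PrimRec f g) [] y" for y by (auto elim: recf_eval.cases)
    then show ?thesis using Nil by (auto simp: implements_def)
  next
    case (Cons a bs)
    have bsn: "set bs \<subseteq> {..<n}" "d \<notin> set bs" using * Cons by auto
    then have "set bs \<subseteq> {..<Suc n}" "d < Suc n" using *(2) by auto
    from implementableD[OF assms(1) this bsn(2)]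
    obtain c1 where c1: "\<And>y s. recf_eval f (map s bs) y \<Longrightarrow> \<forall>r\<ge>Suc n. s r = 0 \<Longrightarrow>
        exec c1 s (s(d := y))"
      by blast
    have "set (Suc n # d # bs) \<subseteq> {..<n+3}" "n + 2 < n + 3" "n + 2 \<notin> set (Suc n # d # bs)"
      using *(2) bsn(1) by auto
    from implementableD[OF assms(2) this]
    obtain c2 where c2: "\<And>y s. recf_eval g (map s (Suc n # d # bs)) y \<Longrightarrow> \<forall>r\<ge>n+3. s r = 0 \<Longrightarrow>
        exec c2 s (s(n + 2 := y))"
      by blast
    \<comment> \<open>Register \<open>n\<close> counts the remaining rounds, \<open>Suc n\<close>
      holds the index and \<open>d\<close> the value at that index. The next value goes to
      \<open>n + 2\<close> first, since \<open>d\<close> is an argument of \<open>g\<close> and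
      cannot be its destination.\<close>
    let ?b = "Seq c2 (Seq (copy (n+2) d (n+3)) (Seq (clear (n+2)) (Seq (Inc (Suc n)) (Dec n))))"
    have loop: "exec (While n ?b) s (s(n := 0, Suc n := s (Suc n) + s n, d := z))"
      if "recf_eval (PrimRec f g) (s (Suc n) # map s bs) (s d)"
        "recf_eval (PrimRec f g) ((s (Suc n) + s n) # map s bs) z" "\<forall>r\<ge>n+2. s r = 0" for s z
      using that
    proof (induction "s n" arbitrary: s)
      case 0
      then have "s d = z" using recf_eval_deterministic by auto
      with 0 have eq: "s(n := 0, Suc n := s (Suc n) + s n, d := z) = s" by auto
      show ?case unfolding eq using 0 by (intro exec_While_0) simp
    next
      case (Suc v)
      \<comment> \<open>A value at the last index forces values at all smaller ones, by descending
        induction.\<close>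
      have "\<exists>w. recf_eval (PrimRec f g) (k # map s bs) w"
        if "k \<le> s (Suc n) + s n" for k
        using that
      proof (induction k rule: inc_induct)
        case base then show ?case using Suc by blast
      next
        case (step k) then show ?case by (auto elim: recf_evalE)
      qed
      from this[of "Suc (s (Suc n))"] obtain w
        where w: "recf_eval (PrimRec f g) (Suc (s (Suc n)) # map s bs) w"
        using Suc(2) by auto
      then have gw: "recf_eval g (s (Suc n) # s d # map s bs) w"
        using recf_eval_deterministic[OF Suc(3)] by (auto elim: recf_evalE)
      let ?s1 = "s(n + 2 := w)" 
      let ?s2 = "?s1(d := w)"
      let ?s3 = "?s2(n + 2 := 0)"
      let ?s4 = "?s3(Suc n := Suc (?s3 (Suc n)))"
      let ?s5 = "?s4(n := ?s4 n - 1)"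
      have e1: "exec c2 s ?s1"
        by (rule c2) (use gw Suc(5) in auto)
      have e2: "exec (copy (n+2) d (n+3)) ?s1 (?s1(d := ?s1 (n + 2)))"
        by (rule exec_copy) (use *(2) Suc(5) in auto)
      then have e2: "exec (copy (n+2) d (n+3)) ?s1 ?s2" by simp
      have e: "exec ?b s ?s5"
        using exec_Seq[OF e1 exec_Seq[OF e2 exec_Seq[OF exec_clear exec_Seq[OF exec_Inc exec_Dec]]]]
        by blast
      have bs: "map ?s5 bs = map s bs"
        using * Cons by auto
      have "exec (While n ?b) ?s5 (?s5(n := 0, Suc n := ?s5 (Suc n) + ?s5 n, d := z))"
      proof (rule Suc(1))
        show "v = ?s5 n" using Suc(2) *(2) by auto
        show "recf_eval (PrimRec f g) (?s5 (Suc n) # map ?s5 bs) (?s5 d)"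
          unfolding bs using w *(2) by auto
        show "recf_eval (PrimRec f g) ((?s5 (Suc n) + ?s5 n) # map ?s5 bs) z"
        proof -
          have "?s5 (Suc n) + ?s5 n = s (Suc n) + s n"
            using *(2) Suc(2) by auto
          then show ?thesis unfolding bs using Suc(4) by simp
        qed
        show "\<forall>r\<ge>n + 2. ?s5 r = 0" using Suc(5) *(2) by auto
      qed
      moreover have "?s5(n := 0, Suc n := ?s5 (Suc n) + ?s5 n, d := z)
          = s(n := 0, Suc n := s (Suc n) + s n, d := z)"
        using Suc(2,5) *(2) by (auto simp: fun_eq_iff)
      ultimately show ?case
        using exec_While_step[OF _ e] Suc(2) by (metis Zero_not_Suc)
    qed
    let ?c = "Seq (copy a n (Suc n)) (Seq c1 (Seq (While n ?b) (clear (Suc n))))"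
    have "implements (PrimRec f g) ?c as d n"
      unfolding implements_def
    proof (intro allI impI)
      fix y s assume "recf_eval (PrimRec f g) (map s as) y" and 0: "\<forall>r\<ge>n. s r = 0"
      then have ev: "recf_eval (PrimRec f g) (s a # map s bs) y" by (simp add: Cons)
      have "\<exists>w. recf_eval (PrimRec f g) (k # map s bs) w" if "k \<le> s a" for k
        using that
      proof (induction k rule: inc_induct)
        case base then show ?case using ev by blast
      next
        case (step k) then show ?case by (auto elim: recf_evalE)
      qed
      from this[of 0] obtain w where w: "recf_eval f (map s bs) w"
        by (auto elim: recf_evalE)
      have ad: "a < n" "a \<noteq> d" "d < n" using * Cons by auto
      let ?s1 = "s(n := s a)" 
      let ?s2 = "?s1(d := w)"
      let ?s3 = "?s2(n := 0, Suc n := ?s2 (Suc n) + ?s2 n, d := y)"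
      have bs: "map ?s1 bs = map s bs" "map ?s2 bs = map s bs"
        using * Cons by auto
      have e1: "exec (copy a n (Suc n)) s ?s1"
        by (rule exec_copy) (use ad 0 in auto)
      have e2: "exec c1 ?s1 ?s2"
        by (rule c1, unfold bs) (use w 0 in auto)
      have e3: "exec (While n ?b) ?s2 ?s3"
      proof (rule loop)
        show "recf_eval (PrimRec f g) (?s2 (Suc n) # map ?s2 bs) (?s2 d)"
          unfolding bs using w 0 ad PrimRec_0 by auto
        show "recf_eval (PrimRec f g) ((?s2 (Suc n) + ?s2 n) # map ?s2 bs) y"
          unfolding bs using ev 0 ad by auto
      qed (use 0 ad in auto)
      have "?s3(Suc n := 0) = s(d := y)"
        using 0 ad by (auto simp: fun_eq_iff)
      then show "exec ?c s (s(d := y))"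
        using exec_Seq[OF e1 exec_Seq[OF e2 exec_Seq[OF e3 exec_clear, of "Suc n"]]] by simp
    qed
    then show ?thesis by blast
  qed
qed

lemma implementable_Mu:
  assumes "implementable f"
  shows "implementable (Mu f)"
  unfolding implementable_def
proof (intro allI impI)
  fix as :: "nat list" and d n :: nat assume *: "set as \<subseteq> {..<n}" "d < n" "d \<notin> set as"
  have "set (n # as) \<subseteq> {..<n + 2}" "Suc n < n + 2" "Suc n \<notin> set (n # as)"
    using * by auto
  from implementableD[OF assms this]
  obtain c where c: "\<And>y s. recf_eval f (map s (n # as)) y \<Longrightarrow> \<forall>r\<ge>n + 2. s r = 0 \<Longrightarrow>
      exec c s (s(Suc n := y))"
    by blast
  have as: "map (s(r := v)) as = map s as" if "n \<le> r" for s r and v :: nat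
    using *(1) that by (auto simp: subset_iff)
  \<comment> \<open>Register \<open>n\<close> holds the candidate and \<open>Suc n\<close> the value
    of \<open>f\<close> there; the body evaluates the next candidate.\<close>
  let ?w = "While (Suc n) (Seq (Inc n) c)"
  have loop: "exec ?w s (s(n := m, Suc n := 0))"
    if "s n \<le> m" "recf_eval f (s n # map s as) (s (Suc n))" "recf_eval f (m # map s as) 0"
      "\<And>k. k < m \<Longrightarrow> \<exists>y. recf_eval f (k # map s as) (Suc y)" "\<forall>r\<ge>n+2. s r = 0" for s m
    using that
  proof (induction "m - s n" arbitrary: s)
    case 0
    then have "s n = m" by simp
    with 0 have "s (Suc n) = 0" using recf_eval_deterministic by blast
    with \<open>s n = m\<close> have eq: "s(n := m, Suc n := 0) = s" by auto
    show ?case unfolding eq using \<open>s (Suc n) = 0\<close> by (rule exec_While_0)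
  next
    case (Suc v)
    then have "s n < m" by simp
    have "s (Suc n) \<noteq> 0"
      using Suc(6)[OF \<open>s n < m\<close>] recf_eval_deterministic[OF Suc(4)] by auto
    obtain y where y: "recf_eval f (Suc (s n) # map s as) y"
      using Suc(5,6) \<open>s n < m\<close> by (cases "Suc (s n) = m") (auto, meson Suc_lessI)
    let ?s1 = "s(n := Suc (s n))"
    let ?s2 = "?s1(Suc n := y)"
    have "exec c ?s1 ?s2"
      by (rule c) (use y Suc(7) in \<open>auto simp: as\<close>)
    then have e: "exec (Seq (Inc n) c) s ?s2"
      by (rule exec_Seq[OF exec_Inc])
    have "exec ?w ?s2 (?s2(n := m, Suc n := 0))"
    proof (rule Suc(1))
      show "v = m - ?s2 n" using Suc(2) by simp
      show "?s2 n \<le> m" using \<open>s n < m\<close> by simp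
      show "recf_eval f (?s2 n # map ?s2 as) (?s2 (Suc n))" using y by (simp add: as)
      show "recf_eval f (m # map ?s2 as) 0" using Suc(5) by (simp add: as)
      show "\<exists>y. recf_eval f (k # map ?s2 as) (Suc y)" if "k < m" for k
        using Suc(6)[OF that] by (simp add: as)
      show "\<forall>r\<ge>n + 2. ?s2 r = 0" using Suc(7) by simp
    qed
    moreover have "?s2(n := m, Suc n := 0) = s(n := m, Suc n := 0)" by (auto simp: fun_eq_iff)
    ultimately have "exec ?w ?s2 (s(n := m, Suc n := 0))" by simp
    with \<open>s (Suc n) \<noteq> 0\<close> e show ?case by (rule exec_While_step)
  qed
  let ?c = "Seq c (Seq ?w (Seq (copy n d (n + 2)) (clear n)))"
  have "implements (Mu f) ?c as d n"
    unfolding implements_def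
  proof (intro allI impI)
    fix m s assume "recf_eval (Mu f) (map s as) m" and 0: "\<forall>r\<ge>n. s r = 0"
    then have m: "recf_eval f (m # map s as) 0"
      "\<And>k. k < m \<Longrightarrow> \<exists>y. recf_eval f (k # map s as) (Suc y)"
      by (blast elim: recf_evalE(7))+
    obtain y where y: "recf_eval f (0 # map s as) y"
      using m by (cases m) auto
    let ?s1 = "s(Suc n := y)"
    let ?s2 = "?s1(n := m, Suc n := 0)"
    let ?s3 = "?s2(d := m)"
    have e1: "exec c s ?s1" by (rule c) (use y 0 in auto)
    have e2: "exec ?w ?s1 ?s2"
      by (rule loop) (use y m 0 in \<open>auto simp: as\<close>)
    have "exec (copy n d (n + 2)) ?s2 (?s2(d := ?s2 n))"
      by (rule exec_copy) (use *(2) 0 in auto)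
    then have e3: "exec (copy n d (n + 2)) ?s2 ?s3" by simp
    have "?s3(n := 0) = s(d := m)" using *(2) 0 by (auto simp: fun_eq_iff)
    then show "exec ?c s (s(d := m))"
      using exec_Seq[OF e1 exec_Seq[OF e2 exec_Seq[OF e3 exec_clear[of n]]]] by simp
  qed
  then show "\<exists>c. implements (Mu f) c as d n" by blast
qed

lemma implementable: "implementable p"
  by (induction p) (auto intro: implementable_Zero implementable_Succ implementable_Proj
      implementable_Comp implementable_PrimRec implementable_Mu)

section \<open>Computable functions\<close>

definition computable :: "nat \<Rightarrow> (nat list \<Rightarrow> nat) \<Rightarrow> bool" where
  "computable k F \<longleftrightarrow> (\<exists>p. \<forall>xs. length xs = k \<longrightarrow> recf_eval p xs (F xs))"

lemma computable_nth: "i < k \<Longrightarrow> computable k (\<lambda>xs. xs ! i)"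
  unfolding computable_def by (blast intro: recf_eval.Proj)

lemma computable_comp:
  assumes "computable (length Gs) F" "\<And>G. G \<in> set Gs \<Longrightarrow> computable k G"
  shows "computable k (\<lambda>xs. F (map (\<lambda>G. G xs) Gs))"
proof -
  obtain p where p: "\<And>xs. length xs = length Gs \<Longrightarrow> recf_eval p xs (F xs)"
    using assms(1) by (auto simp: computable_def)
  obtain q where q: "\<And>G xs. G \<in> set Gs \<Longrightarrow> length xs = k \<Longrightarrow> recf_eval (q G) xs (G xs)"
    using assms(2) unfolding computable_def by metis
  have "recf_eval (Comp p (map q Gs)) xs (F (map (\<lambda>G. G xs) Gs))" if "length xs = k" for xs
    by (rule recf_eval.Comp[where ys = "map (\<lambda>G. G xs) Gs"])
      (auto simp: list_all2_conv_all_nth p q that)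
  then show ?thesis unfolding computable_def by blast
qed

lemma computable_comp1:
  assumes "computable 1 (\<lambda>ys. f (ys ! 0))" "computable k G"
  shows "computable k (\<lambda>xs. f (G xs))"
  using computable_comp[of "[G]" "\<lambda>ys. f (ys ! 0)" k] assms by simp

lemma computable_comp2:
  assumes "computable 2 (\<lambda>ys. f (ys ! 0) (ys ! 1))" "computable k G" "computable k H"
  shows "computable k (\<lambda>xs. f (G xs) (H xs))"
  using computable_comp[of "[G, H]" "\<lambda>ys. f (ys ! 0) (ys ! 1)" k] assms
  by (auto simp: numeral_2_eq_2)

lemma computable_comp3:
  assumes "computable 3 (\<lambda>ys. f (ys ! 0) (ys ! 1) (ys ! 2))"
    "computable k G" "computable k H" "computable k I"
  shows "computable k (\<lambda>xs. f (G xs) (H xs) (I xs))"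
  using computable_comp[of "[G, H, I]" "\<lambda>ys. f (ys ! 0) (ys ! 1) (ys ! 2)" k] assms
  by (auto simp: numeral_3_eq_3)

lemma computable_Suc: "computable k G \<Longrightarrow> computable k (\<lambda>xs. Suc (G xs))"
proof (rule computable_comp1[of Suc])
  show "computable 1 (\<lambda>ys. Suc (ys ! 0))"
    unfolding computable_def
    by (intro exI[of _ Succ]) (auto simp: length_Suc_conv intro: recf_eval.Succ)
qed

lemma computable_const: "computable k (\<lambda>_. c)"
proof (induction c)
  case 0
  then show ?case unfolding computable_def by (blast intro: recf_eval.Zero)
qed (rule computable_Suc)

lemma computable_rec:
  assumes "computable k A" "computable (Suc (Suc k)) G" "computable k N"
  shows "computable k (\<lambda>xs. rec_nat (A xs) (\<lambda>n y. G (n # y # xs)) (N xs))"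
proof -
  obtain p where p: "\<And>xs. length xs = k \<Longrightarrow> recf_eval p xs (A xs)"
    using assms(1) by (auto simp: computable_def)
  obtain q where q: "\<And>xs. length xs = Suc (Suc k) \<Longrightarrow> recf_eval q xs (G xs)"
    using assms(2) by (auto simp: computable_def)
  have "recf_eval (PrimRec p q) (n # xs) (rec_nat (A xs) (\<lambda>n y. G (n # y # xs)) n)"
    if "length xs = k" for n xs
    by (induction n) (auto intro!: recf_eval.PrimRec_0 recf_eval.PrimRec_Suc p q that)
  then have "recf_eval (PrimRec p q) xs
      (rec_nat (A (tl xs)) (\<lambda>n y. G (n # y # tl xs)) (hd xs))" if "length xs = Suc k" for xs
    using that by (auto simp: length_Suc_conv)
  then have "computable (Suc k) (\<lambda>xs. rec_nat (A (tl xs)) (\<lambda>n y. G (n # y # tl xs)) (hd xs))"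
    unfolding computable_def by blast
  \<comment> \<open>\<open>PrimRec\<close> expects its counter in first place; composing with
    \<open>N\<close> and the projections supplies it and keeps \<open>xs\<close>.\<close>
  moreover have "computable k G" if "G \<in> set (N # map (\<lambda>i xs. xs ! i) [0..<k])" for G
    using that assms(3) by (auto simp: computable_nth)
  ultimately have "computable k (\<lambda>xs. rec_nat (A (map (\<lambda>i. xs ! i) [0..<k]))
      (\<lambda>n y. G (n # y # map (\<lambda>i. xs ! i) [0..<k])) (N xs))"
    using computable_comp[of "N # map (\<lambda>i xs. xs ! i) [0..<k]"
        "\<lambda>xs. rec_nat (A (tl xs)) (\<lambda>n y. G (n # y # tl xs)) (hd xs)" k]
    by (simp add: comp_def)
  then obtain r where r: "\<And>xs. length xs = k \<Longrightarrow>
      recf_eval r xs (rec_nat (A (map (\<lambda>i. xs ! i) [0..<k]))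
        (\<lambda>n y. G (n # y # map (\<lambda>i. xs ! i) [0..<k])) (N xs))"
    by (auto simp: computable_def)
  have "recf_eval r xs (rec_nat (A xs) (\<lambda>n y. G (n # y # xs)) (N xs))" if "length xs = k" for xs
  proof -
    have eq: "map (\<lambda>i. xs ! i) [0..<k] = xs" using map_nth[of xs] that by simp
    show ?thesis using r[OF that] unfolding eq .
  qed
  then show ?thesis unfolding computable_def by blast
qed

lemma computable_if_0:
  assumes "computable k C" "computable k A" "computable k B"
  shows "computable k (\<lambda>xs. if C xs = 0 then A xs else B xs)"
proof -
  \<comment> \<open>A recursion whose step ignores the previous value is a case distinction on its
    counter.\<close>
  have "computable 3 (\<lambda>ys. rec_nat (ys ! 1) (\<lambda>n y. ys ! 2) (ys ! 0))"
    using computable_rec[of 3 "\<lambda>ys. ys ! 1" "\<lambda>ys. ys ! 4" "\<lambda>ys. ys ! 0"]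
    by (simp add: computable_nth)
  from computable_comp3[OF this[folded], of k C A B] assms
  have "computable k (\<lambda>xs. rec_nat (A xs) (\<lambda>n y. B xs) (C xs))" 
    using computable_comp3[of "\<lambda>c a b. rec_nat a (\<lambda>n y. b) c"] by simp
  moreover have "rec_nat a (\<lambda>n y. b) c = (if c = 0 then a else b)" for a b c :: nat
    by (cases c) auto
  ultimately show ?thesis by simp
qed

lemma computable_pred: "computable k G \<Longrightarrow> computable k (\<lambda>xs. G xs - 1)"
proof (rule computable_comp1[of "\<lambda>x. x - 1"])
  have "rec_nat 0 (\<lambda>n y. n) x = x - 1" for x :: nat by (cases x) auto
  then show "computable 1 (\<lambda>ys. ys ! 0 - 1)"
    using computable_rec[of 1 "\<lambda>ys. 0" "\<lambda>ys. ys ! 0" "\<lambda>ys. ys ! 0"]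
    by (simp add: computable_nth computable_const)
qed

lemma computable_add:
  assumes "computable k G" "computable k H"
  shows "computable k (\<lambda>xs. G xs + H xs)"
proof (rule computable_comp2[OF _ assms])
  have "rec_nat x (\<lambda>n y. Suc y) z = x + z" for x z :: nat by (induction z) auto
  then show "computable 2 (\<lambda>ys. ys ! 0 + ys ! 1)"
    using computable_rec[of 2 "\<lambda>ys. ys ! 0" "\<lambda>ys. Suc (ys ! 1)" "\<lambda>ys. ys ! 1"]
    by (simp add: computable_nth computable_Suc)
qed

lemma computable_diff:
  assumes "computable k G" "computable k H"
  shows "computable k (\<lambda>xs. G xs - H xs)"
proof (rule computable_comp2[OF _ assms])
  have "rec_nat x (\<lambda>n y. y - 1) z = x - z" for x z :: nat by (induction z) auto
  then show "computable 2 (\<lambda>ys. ys ! 0 - ys ! 1)"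
    using computable_rec[of 2 "\<lambda>ys. ys ! 0" "\<lambda>ys. ys ! 1 - 1" "\<lambda>ys. ys ! 1"]
    by (simp add: computable_nth computable_pred del: One_nat_def)
qed

text \<open>Truncated subtraction decides the order: \<open>C xs < D xs\<close> iff
  \<open>Suc (C xs) - D xs = 0\<close>.\<close>

lemma computable_if_less:
  assumes "computable k C" "computable k D" "computable k A" "computable k B"
  shows "computable k (\<lambda>xs. if C xs < D xs then A xs else B xs)"
  using computable_if_0[OF computable_diff[OF computable_Suc[OF assms(1)] assms(2)] assms(3,4)]
  by (simp add: Suc_le_eq)

lemma computable_if_eq:
  assumes "computable k C" "computable k D" "computable k A" "computable k B"
  shows "computable k (\<lambda>xs. if C xs = D xs then A xs else B xs)"
proof -
  have "(\<lambda>xs. if C xs = D xs then A xs else B xs)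
      = (\<lambda>xs. if (C xs - D xs) + (D xs - C xs) = 0 then A xs else B xs)"
    by auto
  then show ?thesis
    using computable_if_0[OF computable_add[OF computable_diff[OF assms(1,2)]
          computable_diff[OF assms(2,1)]] assms(3,4)] by (simp only:)
qed

lemma computable_mod_3:
  assumes "computable k G"
  shows "computable k (\<lambda>xs. G xs mod 3)"
proof (rule computable_comp1[OF _ assms])
  have "rec_nat 0 (\<lambda>n y. if y = 2 then 0 else Suc y) x = x mod 3" for x :: nat
    by (induction x) (auto simp: mod_Suc)
  moreover have "computable (Suc (Suc 1)) (\<lambda>ys. if ys ! 1 = 2 then 0 else Suc (ys ! 1))"
    by (intro computable_if_eq computable_nth computable_const computable_Suc) auto
  from computable_rec[OF computable_const[of 1 0] this computable_nth[of 0 1]]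
  have "computable 1 (\<lambda>ys. rec_nat 0 (\<lambda>n y. if y = 2 then 0 else Suc y) (ys ! 0))"
    by (simp cong: if_cong)
  ultimately show "computable 1 (\<lambda>ys. ys ! 0 mod 3)" by simp
qed

section \<open>Codes of pairs, lists and tables\<close>

lemma computable_triangle:
  assumes "computable k G"
  shows "computable k (\<lambda>xs. triangle (G xs))"
proof (rule computable_comp1[OF _ assms])
  have "rec_nat 0 (\<lambda>n y. y + Suc n) x = triangle x" for x :: nat
    by (induction x) auto
  moreover have "computable (Suc (Suc 1)) (\<lambda>ys. ys ! 1 + Suc (ys ! 0))"
    by (intro computable_add computable_nth computable_Suc) auto
  from computable_rec[OF computable_const[of 1 0] this computable_nth[of 0 1]]
  have "computable 1 (\<lambda>ys. rec_nat 0 (\<lambda>n y. y + Suc n) (ys ! 0))"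
    by simp
  ultimately show "computable 1 (\<lambda>ys. triangle (ys ! 0))" by simp
qed

lemma computable_prod_encode:
  assumes "computable k G" "computable k H"
  shows "computable k (\<lambda>xs. prod_encode (G xs, H xs))"
  unfolding prod_encode_def
  by (simp, intro computable_add computable_triangle assms)

text \<open>The greatest \<open>w\<close> with \<open>triangle w <= z\<close>, that is, the
  antidiagonal of the pairing function on which \<open>z\<close> lies, found by recursion on
  \<open>z\<close> instead of a search.\<close>

definition triangle_root :: "nat \<Rightarrow> nat" where
  "triangle_root z = rec_nat 0 (\<lambda>n w. if triangle (Suc w) = Suc n then Suc w else w) z"

lemma triangle_root: "triangle (triangle_root z) \<le> z \<and> z < triangle (Suc (triangle_root z))"
  by (induction z) (auto simp: triangle_root_def)

lemma triangle_mono: "m \<le> n \<Longrightarrow> triangle m \<le> triangle n"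
  by (induction n rule: dec_induct) auto

lemma triangle_root_prod_encode: "triangle_root (prod_encode (x, y)) = x + y"
proof -
  let ?z = "prod_encode (x, y)"
  have "triangle (x + y) \<le> ?z" "?z < triangle (Suc (x + y))"
    by (auto simp: prod_encode_def)
  with triangle_root[of ?z] triangle_mono show ?thesis
    by (metis Suc_leI linorder_neqE_nat not_less order.strict_trans1 order.strict_trans2)
qed

lemma computable_triangle_root:
  assumes "computable k G"
  shows "computable k (\<lambda>xs. triangle_root (G xs))"
proof (rule computable_comp1[OF _ assms])
  let ?G = "\<lambda>ys. if triangle (Suc (ys ! 1)) = Suc (ys ! 0) then Suc (ys ! 1) else ys ! 1"
  have "computable (Suc (Suc 1)) ?G"
    by (intro computable_if_eq computable_triangle computable_nth computable_Suc) auto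
  from computable_rec[OF computable_const[of 1 0] this computable_nth[of 0 1]]
  show "computable 1 (\<lambda>ys. triangle_root (ys ! 0))"
    unfolding triangle_root_def by (simp del: triangle_Suc cong: if_cong)
qed

text \<open>If \<open>z = triangle (x + y) + x\<close>, the root is \<open>x + y\<close> and the
  offset from its triangle is \<open>x\<close>.\<close>

lemma prod_decode_triangle_root:
  "prod_decode z = (let x = z - triangle (triangle_root z) in (x, triangle_root z - x))"
proof -
  obtain x y where z: "z = prod_encode (x, y)"
    by (metis prod_decode_inverse surj_pair)
  then have "triangle_root z = x + y" "z - triangle (x + y) = x"
    by (simp_all add: triangle_root_prod_encode) (simp add: prod_encode_def)
  then show ?thesis using z by (simp add: Let_def)
qed

lemma
  assumes "computable k G"
  shows computable_fst_prod_decode: "computable k (\<lambda>xs. fst (prod_decode (G xs)))"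
    and computable_snd_prod_decode: "computable k (\<lambda>xs. snd (prod_decode (G xs)))"
  unfolding prod_decode_triangle_root Let_def fst_conv snd_conv
  by (intro computable_diff computable_triangle computable_triangle_root assms)+

text \<open>As \<open>list_encode (x # xs)\<close> is
  \<open>Suc (prod_encode (x, list_encode xs))\<close>, subtracting 1 and decoding splits off the
  head; the recursion drops \<open>k\<close> heads.\<close>

definition code_nth :: "nat \<Rightarrow> nat \<Rightarrow> nat" where
  "code_nth c k = fst (prod_decode (rec_nat c (\<lambda>_ y. snd (prod_decode (y - 1))) k - 1))"

lemma code_nth_list_encode:
  assumes "k < length xs"
  shows "code_nth (list_encode xs) k = xs ! k"
proof -
  have "rec_nat (list_encode xs) (\<lambda>_ y. snd (prod_decode (y - 1))) k = list_encode (drop k xs)"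
    using assms
  proof (induction k)
    case (Suc k)
    then have "drop k xs = xs ! k # drop (Suc k) xs" by (simp add: Cons_nth_drop_Suc)
    then show ?case using Suc by simp
  qed simp
  moreover have "drop k xs = xs ! k # drop (Suc k) xs"
    using assms by (simp add: Cons_nth_drop_Suc)
  ultimately show ?thesis by (simp add: code_nth_def)
qed

lemma computable_code_nth:
  assumes "computable k G" "computable k H"
  shows "computable k (\<lambda>xs. code_nth (G xs) (H xs))"
proof (rule computable_comp2[OF _ assms])
  let ?G = "\<lambda>ys. snd (prod_decode (ys ! 1 - 1))"
  have "computable 4 ?G"
    by (intro computable_snd_prod_decode computable_pred computable_nth) auto
  then have "computable 2 (\<lambda>ys. rec_nat (ys ! 0) (\<lambda>n y. snd (prod_decode (y - 1))) (ys ! 1))"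
    using computable_rec[of 2 "\<lambda>ys. ys ! 0" ?G "\<lambda>ys. ys ! 1"]
    by (simp add: computable_nth)
  then show "computable 2 (\<lambda>ys. code_nth (ys ! 0) (ys ! 1))"
    unfolding code_nth_def by (intro computable_fst_prod_decode computable_pred)
qed

text \<open>Recursion on the length of a list that is being encoded proceeds from its end.\<close>

lemma list_encode_map_append:
  "list_encode (map h [0..<n] @ ys) =
    rec_nat (list_encode ys) (\<lambda>i y. Suc (prod_encode (h (n - Suc i), y))) n"
proof -
  have "rec_nat (list_encode ys) (\<lambda>i y. Suc (prod_encode (h (n - Suc i), y))) i
      = list_encode (map h [n - i..<n] @ ys)" if "i \<le> n" for i
    using that
  proof (induction i)
    case (Suc i)
    then have "[n - Suc i..<n] = (n - Suc i) # [n - i..<n]"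
      by (simp add: upt_conv_Cons Suc_diff_Suc)
    then show ?case using Suc by simp
  qed simp
  from this[of n] show ?thesis by simp
qed

text \<open>Two nested recursions: the inner one puts a row in front of an encoded list, the outer
  one adds the rows from the last to the first.\<close>

lemma computable_table:
  assumes "computable 3 (\<lambda>ys. h (ys ! 0) (ys ! 1) (ys ! 2))" "computable 1 (\<lambda>ys. N (ys ! 0))"
  shows "computable 1 (\<lambda>ys. list_encode [h (ys ! 0) x y. x \<leftarrow> [0..<N (ys ! 0)], y \<leftarrow> [0..<N (ys ! 0)]])"
proof -
  let ?row = "\<lambda>c x a. rec_nat a (\<lambda>i y. Suc (prod_encode (h c x (N c - Suc i), y))) (N c)"
  have row: "?row c x (list_encode ys) = list_encode (map (h c x) [0..<N c] @ ys)" for c x ys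
    by (simp add: list_encode_map_append)
  let ?G = "\<lambda>ys. Suc (prod_encode (h (ys ! 2) (ys ! 3) (N (ys ! 2) - Suc (ys ! 0)), ys ! 1))"
  have "computable 5 ?G"
    by (intro computable_Suc computable_prod_encode computable_comp3[OF assms(1)]
        computable_diff computable_comp1[OF assms(2)] computable_nth) auto
  then have row_computable: "computable 3 (\<lambda>ys. ?row (ys ! 0) (ys ! 1) (ys ! 2))"
    using computable_rec[of 3 "\<lambda>ys. ys ! 2" ?G "\<lambda>ys. N (ys ! 0)"]
      computable_comp1[OF assms(2) computable_nth[of 0 3]]
    by (simp add: computable_nth)
  have "rec_nat 0 (\<lambda>i y. ?row c (N c - Suc i) y) n
      = list_encode (concat (map (\<lambda>x. map (h c x) [0..<N c]) [N c - n..<N c]))"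
    if "n \<le> N c" for n c
    using that
  proof (induction n)
    case (Suc n)
    then have "[N c - Suc n..<N c] = (N c - Suc n) # [N c - n..<N c]"
      by (simp add: upt_conv_Cons Suc_diff_Suc)
    then show ?case using Suc row[where c = c and x = "N c - Suc n"] by simp
  qed simp
  from this[of "N _"] have table: "rec_nat 0 (\<lambda>i y. ?row c (N c - Suc i) y) (N c)
      = list_encode [h c x y. x \<leftarrow> [0..<N c], y \<leftarrow> [0..<N c]]" for c by simp
  let ?G = "\<lambda>ys. ?row (ys ! 2) (N (ys ! 2) - Suc (ys ! 0)) (ys ! 1)"
  have "computable (Suc (Suc 1)) ?G"
    by (intro computable_comp3[OF row_computable, where G = "\<lambda>ys. ys ! 2" and
          H = "\<lambda>ys. N (ys ! 2) - Suc (ys ! 0)" and I = "\<lambda>ys. ys ! 1"]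
        computable_diff computable_comp1[OF assms(2)] computable_nth computable_Suc) auto
  from computable_rec[OF computable_const[of 1 0] this assms(2)]
  have "computable 1 (\<lambda>ys. rec_nat 0
      (\<lambda>i y. ?row (ys ! 0) (N (ys ! 0) - Suc i) y) (N (ys ! 0)))"
    by simp
  then show ?thesis unfolding table .
qed

section \<open>The cellular simulation\<close>

text \<open>Row \<open>i + 1\<close> of the development shows the configuration of the program after \<open>i\<close> steps: the cell at
  distance \<open>p\<close> from the diagonal is \<open>Live (p mod 3) q A B C e\<close>, where \<open>q\<close> is the stack and
  \<open>A\<close>, \<open>B\<close>, \<open>C\<close> are the sets of registers with value greater than \<open>p - 2\<close>, \<open>p - 1\<close>, \<open>p\<close>
  (sets whose threshold would be negative are \<open>{0}\<close> by convention). The flag \<open>e\<close> is 1 and 2 on the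
  last two live cells of the row and 0 elsewhere. \<open>Wall\<close> is the start symbol and \<open>Blank\<close> the white
  colour.\<close>

datatype cell = Blank | Wall | Kill
  | Live nat "com list" "nat set" "nat set" "nat set" nat

text \<open>The result is the new set for the threshold of \<open>B\<close>. After
  \<open>Inc r\<close>, register \<open>r\<close> exceeds it iff the old value exceeded the
  threshold one lower (\<open>A\<close>); after \<open>Dec r\<close>, iff it exceeded the one higher
  (\<open>C\<close>).\<close>

fun next_bits :: "com list \<Rightarrow> nat set \<Rightarrow> nat set \<Rightarrow> nat set \<Rightarrow> nat set" where
  "next_bits (Inc r # K) A B C = B \<union> ({r} \<inter> A)"
| "next_bits (Dec r # K) A B C = B - ({r} - C)"
| "next_bits _ A B C = B"

text \<open>Beyond the live part of the row above, two more cells are appended; thus the live part always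
  exceeds the values of all registers, which grow by at most 1 per step.\<close>

fun extend :: "cell \<Rightarrow> cell" where
  "extend (Live l q A B C e) = (if e < 2 then Live (Suc l mod 3) q B C {} (Suc e) else Blank)"
| "extend _ = Blank"

text \<open>The first argument is the upper neighbour: it is one step further from the diagonal than the new
  cell, so its sets carry the thresholds needed to update the bit of the new cell.\<close>

fun inner :: "cell \<Rightarrow> cell \<Rightarrow> cell" where
  "inner (Live l q A B C e) (Live l' q' A' B' C' e') =
     Live (Suc l' mod 3) q' B' C' (next_bits q A B C) 0"
| "inner _ _ = Blank"

text \<open>Both neighbours of a diagonal cell are equal and at distance 1, and \<open>B\<close> consists of the
  registers that are not zero. \<open>UNIV\<close> stands for the threshold \<open>-1\<close>.\<close>

fun diagonal :: "cell \<Rightarrow> cell" where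
  "diagonal (Live l q A B C e) =
     (if next_stack q B = [] then Kill
      else Live 0 (next_stack q B) {0} {0} (next_bits q UNIV B C) 0)"
| "diagonal _ = Blank"

text \<open>The labels modulo 3 tell the upper neighbour from the left one, which is how a symmetric rule
  can simulate an asymmetric one.\<close>

fun combine :: "cell \<Rightarrow> cell \<Rightarrow> cell" where
  "combine (Live l q A B C e) (Live l' q' A' B' C' e') =
     (let x = Live l q A B C e; y = Live l' q' A' B' C' e' in
      if l' = Suc l mod 3 then inner x y
      else if l = Suc l' mod 3 then inner y x
      else if x = y then diagonal x else Blank)"
| "combine (Live l q A B C e) Kill = Kill"
| "combine Kill (Live l q A B C e) = Kill"
| "combine Kill Kill = Kill"
| "combine (Live l q A B C e) y = extend (Live l q A B C e)"
| "combine x (Live l q A B C e) = extend (Live l q A B C e)"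
| "combine x y = Blank"

text \<open>The two orientations of live neighbours exclude each other: no label is its own second
  successor modulo 3.\<close>

lemma combine_commute: "combine x y = combine y x"
proof -
  have "\<not> (l' = Suc l mod 3 \<and> l = Suc l' mod 3)" for l l' :: nat by presburger
  then show ?thesis by (cases x; cases y) (auto simp: Let_def)
qed

text \<open>The condition \<open>x < s r + 2\<close> expresses the threshold \<open>x - 2\<close>
  without subtraction. At \<open>x = 1\<close> the first set is \<open>UNIV\<close>, the diagonal
  case. At \<open>x = 0\<close> the middle threshold would be -1, and \<open>Dec\<close> on a zero
  register would wrongly lose its bit.\<close>

lemma next_bits:
  assumes "1 \<le> x"
  shows "next_bits q {r. x < s r + 2} {r. Suc x < s r + 2} {r. Suc (Suc x) < s r + 2}
    = {r. Suc x < next_store q s r + 2}"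
  using assms by (cases "(q, s)" rule: next_store.cases) auto

section \<open>Correctness of the simulation\<close>

locale ca_run =
  fixes q0 :: "com list" and n :: nat and a :: "nat \<Rightarrow> nat \<Rightarrow> cell"
  assumes q0: "q0 \<noteq> []"
    and sym: "a i j = a j i"
    and first_row: "a 0 p = (if p \<le> Suc n
      then Live (p mod 3) q0 {0} (if p < Suc n then {0} else {}) (if p < n then {0} else {})
        (if p < n then 0 else if p = n then 1 else 2)
      else Blank)"
    and rec: "a (Suc i) (Suc j) = combine (a i (Suc j)) (a (Suc i) j)"
begin

definition config :: "nat \<Rightarrow> com list \<times> (nat \<Rightarrow> nat)" where
  "config i = (step ^^ i) (q0, (\<lambda>_. 0)(0 := n))"

definition Q :: "nat \<Rightarrow> com list" where "Q i = fst (config i)"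
definition S :: "nat \<Rightarrow> nat \<Rightarrow> nat" where "S i = snd (config i)"

lemma Q_0: "Q 0 = q0" and S_0: "S 0 = (\<lambda>_. 0)(0 := n)"
  and Q_Suc: "Q (Suc i) = next_stack (Q i) {r. 0 < S i r}"
  and S_Suc: "S (Suc i) = next_store (Q i) (S i)"
  by (simp_all add: Q_def S_def config_def step_def)

lemma S_le: "S i r \<le> n + i"
proof (induction i arbitrary: r)
  case (Suc i)
  have "next_store q s r \<le> n + Suc i" if "\<And>r. s r \<le> n + i" for q s
    using that[of r] by (cases "(q, s)" rule: next_store.cases) auto
  then show ?case using Suc by (simp add: S_Suc)
qed (simp add: S_0)

text \<open>For a negative threshold all registers would qualify; the convention \<open>{0}\<close>
  stays finite and lets the first \<open>n\<close> cells of row 0 differ in their labels only, so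
  that three cells suffice for the input chain.\<close>

definition bits :: "nat \<Rightarrow> nat \<Rightarrow> nat set" where
  "bits i x = (if x < 2 then {0} else {r. x < S i r + 2})"

definition flag :: "nat \<Rightarrow> nat \<Rightarrow> nat" where
  "flag i p = (if p < n + i then 0 else if p = n + i then 1 else 2)"

definition expected :: "nat \<Rightarrow> nat \<Rightarrow> cell" where
  "expected i p = (if p \<le> Suc (n + i)
     then Live (p mod 3) (Q i) (bits i p) (bits i (Suc p)) (bits i (Suc (Suc p))) (flag i p)
     else Blank)"

lemma bits_Suc: "next_bits (Q i) (bits i (Suc (Suc p))) (bits i (Suc (Suc (Suc p))))
    (bits i (Suc (Suc (Suc (Suc p))))) = bits (Suc i) (Suc (Suc (Suc p)))"
  using next_bits[of "Suc (Suc p)" "Q i" "S i"] by (simp add: bits_def S_Suc)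

lemma bits_Suc_diagonal:
  "next_bits (Q i) UNIV (bits i (Suc (Suc 0))) (bits i (Suc (Suc (Suc 0))))
    = bits (Suc i) (Suc (Suc 0))"
  using next_bits[of 1 "Q i" "S i"] by (simp add: bits_def S_Suc)

lemma bits_empty: "n + i \<le> p \<Longrightarrow> bits i (Suc (Suc p)) = {}"
  using S_le[of i] by (auto simp: bits_def not_less intro: order.trans)

lemma expected_0: "a 0 p = expected 0 p"
  unfolding first_row expected_def Q_0 bits_def flag_def S_0 by (auto simp: less_Suc_eq)

lemma diagonal_expected:
  "combine (expected i 1) (expected i 1) = (if Q (Suc i) = [] then Kill else expected (Suc i) 0)"
proof -
  have "next_stack (Q i) (bits i (Suc (Suc 0))) = Q (Suc i)"
    by (simp add: bits_def Q_Suc)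
  moreover have "bits (Suc i) 0 = {0}" "bits (Suc i) (Suc 0) = {0}"
    by (simp_all add: bits_def)
  ultimately show ?thesis
    using bits_Suc_diagonal[of i] by (simp add: expected_def Let_def flag_def)
qed

lemma inner_expected:
  "combine (expected i (Suc (Suc p))) (expected (Suc i) p) = expected (Suc i) (Suc p)"
proof -
  have mod: "p mod 3 = Suc (Suc (Suc p) mod 3) mod 3" "Suc p mod 3 = Suc (p mod 3) mod 3"
    by presburger+
  \<comment> \<open>Either the upper neighbour is live, or it is blank and the left one has flag 0
    (first appended cell), flag 1 (second one), or is already the last live cell or blank.\<close>
  consider "Suc (Suc p) \<le> Suc (n + i)" | "p = n + i" | "p = Suc (n + i)" | "p > Suc (n + i)"
    by linarith
  then show ?thesis
  proof cases
    case 1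
    then show ?thesis
      using mod bits_Suc[of i p] by (simp add: expected_def Let_def flag_def)
  qed (use mod bits_empty[of "Suc i" "Suc p"] in \<open>simp_all add: expected_def flag_def\<close>)
qed

lemma a_expected:
  assumes "\<forall>k\<le>i. Q k \<noteq> []"
  shows "a i (i + p) = expected i p"
  using assms
proof (induction i arbitrary: p)
  case 0
  then show ?case by (simp add: expected_0)
next
  case (Suc i)
  then have IH: "a i (i + p) = expected i p" for p by simp
  show ?case
  proof (induction p)
    case 0
    have "a (Suc i) (Suc i) = combine (expected i 1) (expected i 1)"
      using rec[of i i] sym[of "Suc i" i] IH[of 1] by simp
    then show ?case using diagonal_expected[of i] Suc.prems by simp
  next
    case (Suc p)
    then show ?case
      using rec[of i "i + Suc p"] IH[of "Suc (Suc p)"] inner_expected[of i p] by simp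
  qed
qed

text \<open>Column \<open>c\<close> is that of the last live cell of row \<open>i\<close>.
  \<open>Kill\<close> spreads next to live cells and other \<open>Kill\<close> cells but not next to
  \<open>Blank\<close>, so it fills exactly the square with both coordinates from
  \<open>Suc i\<close> to \<open>c\<close>.\<close>

lemma a_killed:
  assumes "\<forall>k\<le>i. Q k \<noteq> []" "Q (Suc i) = []"
  defines "c \<equiv> Suc (2 * i + n)"
  shows "a (Suc i + u) (Suc i + v) = (if Suc i + u \<le> c \<and> Suc i + v \<le> c then Kill else Blank)"
proof -
  have row: "a (Suc i) (Suc i + v) = (if Suc i + v \<le> c then Kill else Blank)" for v
  proof (induction v)
    case 0
    have "a (Suc i) (Suc i) = combine (expected i 1) (expected i 1)"
      using rec[of i i] sym[of "Suc i" i] a_expected[OF assms(1), of 1] by simp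
    then show ?case using diagonal_expected[of i] assms(2) by (simp add: c_def)
  next
    case (Suc v)
    have "a (Suc i) (Suc i + Suc v) = combine (expected i (Suc (Suc v))) (a (Suc i) (Suc i + v))"
      using rec[of i "Suc i + v"] a_expected[OF assms(1), of "Suc (Suc v)"] by simp
    then show ?case using Suc by (auto simp: expected_def c_def)
  qed
  show ?thesis
  proof (induction u arbitrary: v)
    case 0
    then show ?case using row[of v] by (simp add: c_def)
  next
    case (Suc u)
    note IH = Suc.IH
    show ?case
    proof (induction v)
      case 0
      then show ?case using row[of "Suc u"] sym[of "Suc i" "Suc i + Suc u"] by (simp add: c_def)
    next
      case (Suc v)
      then show ?case
        using rec[of "Suc i + u" "Suc i + v"] IH[of "Suc v"] by auto
    qed
  qed
qed

lemma ultimately_Blank_iff_halts: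
  "(\<exists>N. \<forall>i j. i + j > N \<longrightarrow> a i j = Blank) \<longleftrightarrow>
    (\<exists>t. fst ((step ^^ t) (q0, (\<lambda>_. 0)(0 := n))) = [])"
proof
  assume "\<exists>N. \<forall>i j. i + j > N \<longrightarrow> a i j = Blank"
  then obtain N where N: "\<And>i j. i + j > N \<Longrightarrow> a i j = Blank" by blast
  have "\<exists>t. Q t = []"
  proof (rule ccontr)
    assume "\<nexists>t. Q t = []"
    then have "a (Suc N) (Suc N) = expected (Suc N) 0"
      using a_expected[of "Suc N" 0] by simp
    then show False using N[of "Suc N" "Suc N"] by (simp add: expected_def)
  qed
  then show "\<exists>t. fst ((step ^^ t) (q0, (\<lambda>_. 0)(0 := n))) = []" by (simp add: Q_def config_def)
next
  assume "\<exists>t. fst ((step ^^ t) (q0, (\<lambda>_. 0)(0 := n))) = []"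
  then have "\<exists>t. Q t = []" by (simp add: Q_def config_def)
  \<comment> \<open>The first halting time: all stacks before it are nonempty.\<close>
  define t where "t = (LEAST t. Q t = [])"
  have "Q t = []" unfolding t_def using \<open>\<exists>t. Q t = []\<close> by (rule LeastI_ex)
  then have "t \<noteq> 0" using q0 Q_0 by metis
  then obtain i where i: "t = Suc i" by (cases t) auto
  have live: "\<forall>k\<le>i. Q k \<noteq> []"
    using i by (metis t_def le_imp_less_Suc not_less_Least)
  \<comment> \<open>The bound forces the larger coordinate \<open>m\<close> beyond the killed square
    and beyond the live part of each row up to \<open>i\<close>.\<close>
  have "a k m = Blank" if km: "k + m > 2 * Suc (2 * i + n)" "k \<le> m" for k m
  proof (cases "k \<le> i")
    case True
    then have "a k m = expected k (m - k)"
      using a_expected[of k "m - k"] live km(2) by simp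
    then show ?thesis using True km by (simp add: expected_def)
  next
    case False
    then obtain u v where "k = Suc i + u" "m = Suc i + v"
      using km(2) by (metis le_add_diff_inverse not_less_eq_eq order.trans)
    then show ?thesis
      using a_killed[OF live, of u v] km \<open>Q t = []\<close> i by auto
  qed
  then have "\<forall>k m. k + m > 2 * Suc (2 * i + n) \<longrightarrow> a k m = Blank"
    by (metis add.commute nle_le sym)
  then show "\<exists>N. \<forall>i j. i + j > N \<longrightarrow> a i j = Blank" by blast
qed

end

section \<open>Finite systems with input\<close>

text \<open>The stacks that can occur while \<open>c\<close> runs on top of \<open>K\<close>; their finiteness keeps the set of cells
  finite.\<close>

fun conts :: "com \<Rightarrow> com list \<Rightarrow> com list set" where
  "conts (Seq a b) K = insert (Seq a b # K) (conts a (b # K) \<union> conts b K)"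
| "conts (While r a) K = insert (While r a # K) (conts a (While r a # K))"
| "conts c K = {c # K}"

lemma finite_conts: "finite (conts c K)"
  by (induction c K rule: conts.induct) auto

lemma Cons_in_conts: "c # K \<in> conts c K"
  by (cases c) auto

lemma next_stack_conts: "q \<in> conts c K \<Longrightarrow> next_stack q P \<in> insert K (conts c K)"
proof (induction c K rule: conts.induct)
  case (1 a b K)
  then show ?case using Cons_in_conts[of a "b # K"] Cons_in_conts[of b K] by auto
next
  case (2 r a K)
  then show ?case using Cons_in_conts[of a "While r a # K"] by (cases "r \<in> P") auto
qed auto

definition cells :: "com list set \<Rightarrow> nat set \<Rightarrow> cell set" where
  "cells X R = {Blank, Wall, Kill} \<union>
     {Live l q A B C e |l q A B C e. l < 3 \<and> q \<in> X \<and> A \<subseteq> R \<and> B \<subseteq> R \<and> C \<subseteq> R \<and> e < 3}"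

lemma finite_cells:
  assumes "finite X" "finite R"
  shows "finite (cells X R)"
proof -
  have "cells X R = {Blank, Wall, Kill} \<union> (\<lambda>(l, q, A, B, C, e). Live l q A B C e) `
      ({..<3} \<times> X \<times> Pow R \<times> Pow R \<times> Pow R \<times> {..<3})"
    by (auto simp: cells_def image_iff)
  then show ?thesis using assms by simp
qed

lemma next_bits_subset:
  "A \<subseteq> R \<Longrightarrow> B \<subseteq> R \<Longrightarrow> next_bits q A B C \<subseteq> R"
  by (cases "(q, A, B, C)" rule: next_bits.cases) auto

lemma combine_cases:
  "combine x y \<in> {extend x, extend y, inner x y, inner y x, diagonal x, Blank, Kill}"
  by (cases x; cases y) (auto simp: Let_def simp del: extend.simps inner.simps diagonal.simps)

lemma combine_in_cells:
  assumes X: "\<And>q P. q \<in> X \<Longrightarrow> next_stack q P \<noteq> [] \<Longrightarrow> next_stack q P \<in> X"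
    and R: "0 \<in> R" "\<And>r K. Inc r # K \<in> X \<Longrightarrow> r \<in> R"
    and xy: "x \<in> cells X R" "y \<in> cells X R"
  shows "combine x y \<in> cells X R"
proof -
  have extend: "extend x \<in> cells X R" if "x \<in> cells X R" for x
    using that by (cases x) (auto simp: cells_def)
  have inner: "inner x y \<in> cells X R" if "x \<in> cells X R" "y \<in> cells X R" for x y
    using that next_bits_subset by (cases x; cases y) (auto simp: cells_def)
  \<comment> \<open>With \<open>UNIV\<close> for \<open>A\<close>, the only new register is the one
    being incremented; hence \<open>R\<close> has to contain all registers that \<open>Inc\<close>
    mentions.\<close>
  have "next_bits q UNIV B C \<subseteq> R" if "q \<in> X" "B \<subseteq> R" for q B C
    using that R(2) by (cases "(q, B, B, C)" rule: next_bits.cases) auto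
  then have diagonal: "diagonal x \<in> cells X R" if "x \<in> cells X R" for x
    using that X R(1) by (cases x) (auto simp: cells_def)
  have Blank: "Blank \<in> cells X R" and Kill: "Kill \<in> cells X R"
    by (auto simp: cells_def)
  show ?thesis
    using extend[OF xy(1)] extend[OF xy(2)] inner[OF xy] inner[OF xy(2,1)] diagonal[OF xy(1)] Blank Kill
      combine_cases[of x y] by auto
qed

text \<open>Serves to show that the start symbol never reappears inside the development, so that the
  chain clauses of the extended rule act only along the border.\<close>

lemma combine_neq_Wall: "combine x y \<noteq> Wall"
proof -
  have "extend x \<noteq> Wall" "inner x y \<noteq> Wall" "diagonal x \<noteq> Wall" for x y
    by (cases x; cases y; simp)+
  then show ?thesis using combine_cases[of x y] by (metis cell.distinct insertE empty_iff)
qed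

section \<open>Systems extended by an input chain\<close>

text \<open>The number \<open>c\<close> encodes the list of the number \<open>m\<close> of states of a system, followed by the table of
  its rule in the order given by \<open>prod_encode\<close>. The extension has the additional states
  \<open>m, \<dots>, m + c - 1\<close>, which the first row runs through; in the other rows the state \<open>m + p\<close>
  acts like the state \<open>2 + p mod 3\<close>. In this way the first row feeds the number \<open>c\<close> to the
  simulated program.\<close>

definition old_state :: "nat \<Rightarrow> nat \<Rightarrow> nat" where
  "old_state c x = (if x < code_nth c 0 then x else 2 + (x - code_nth c 0) mod 3)"

definition extended_rule :: "nat \<Rightarrow> nat \<Rightarrow> nat \<Rightarrow> nat" where
  "extended_rule c x y =
    (if x = 1 \<and> y = 1 then code_nth c 0
     else if x = 1 \<and> code_nth c 0 \<le> y \<and> Suc y < code_nth c 0 + c then Suc y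
     else if y = 1 \<and> code_nth c 0 \<le> x \<and> Suc x < code_nth c 0 + c then Suc x
     else code_nth c (Suc (prod_encode (old_state c x, old_state c y))))"

definition extension :: "nat \<Rightarrow> nat drs" where
  "extension c = \<lparr>states = {..<code_nth c 0 + c}, rule = extended_rule c, white = 0, start = 1\<rparr>"

lemma computable_drs_code_extension: "computable 1 (\<lambda>xs. drs_code (extension (xs ! 0)))"
proof -
  have m: "computable k (\<lambda>xs. code_nth (xs ! i) 0)" if "i < k" for i k
    using that by (intro computable_code_nth computable_nth computable_const)
  have old: "computable k (\<lambda>xs. old_state (xs ! i) (xs ! j))" if "i < k" "j < k" for i j k
    unfolding old_state_def using that
    by (intro computable_if_less computable_add computable_mod_3 computable_diff computable_nth
        computable_const m)
  \<comment> \<open>Nested case distinctions on equality and strict order match the closure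
    lemmas.\<close>
  have "extended_rule c x y =
     (if x = 1 then if y = 1 then code_nth c 0
        else if code_nth c 0 < Suc y then if Suc y < code_nth c 0 + c then Suc y
          else code_nth c (Suc (prod_encode (old_state c x, old_state c y)))
        else code_nth c (Suc (prod_encode (old_state c x, old_state c y)))
      else if y = 1 then
        if code_nth c 0 < Suc x then if Suc x < code_nth c 0 + c then Suc x
          else code_nth c (Suc (prod_encode (old_state c x, old_state c y)))
        else code_nth c (Suc (prod_encode (old_state c x, old_state c y)))
      else code_nth c (Suc (prod_encode (old_state c x, old_state c y))))" for c x y
    by (auto simp: extended_rule_def)
  then have "computable 3 (\<lambda>ys. extended_rule (ys ! 0) (ys ! 1) (ys ! 2))"
    by (simp only:) (intro computable_if_less computable_if_eq computable_Suc computable_add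
        computable_code_nth computable_prod_encode computable_nth computable_const m old; simp)
  moreover have size: "computable 1 (\<lambda>ys. code_nth (ys ! 0) 0 + ys ! 0)"
    by (intro computable_add m computable_nth) auto
  ultimately have "computable 1 (\<lambda>ys. list_encode [extended_rule (ys ! 0) x y.
      x \<leftarrow> [0..<code_nth (ys ! 0) 0 + ys ! 0], y \<leftarrow> [0..<code_nth (ys ! 0) 0 + ys ! 0]])"
    by (rule computable_table)
  then show ?thesis
    unfolding drs_code_def extension_def Let_def list_encode.simps
    using size
    by (simp, intro computable_Suc computable_prod_encode computable_const)
qed

text \<open>The cells of \<open>A\<close> are numbered by \<open>enc\<close>, with inverse
  \<open>dec\<close>; the states 2, 3 and 4 are the initial cells that the chain imitates. The same
  number \<open>c\<close> serves as table and as input.\<close>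

locale extension_run =
  fixes q0 :: "com list" and A :: "cell set" and dec :: "nat \<Rightarrow> cell" and enc :: "cell \<Rightarrow> nat"
    and m c :: nat
  assumes q0: "q0 \<noteq> []"
    and m: "5 \<le> m"
    and A: "\<And>x y. x \<in> A \<Longrightarrow> y \<in> A \<Longrightarrow> combine x y \<in> A"
    and dec: "\<And>i. i < m \<Longrightarrow> dec i \<in> A" "\<And>i. i < m \<Longrightarrow> enc (dec i) = i"
    and enc: "\<And>x. x \<in> A \<Longrightarrow> enc x < m" "\<And>x. x \<in> A \<Longrightarrow> dec (enc x) = x"
    and dec_0: "dec 0 = Blank" and dec_1: "dec 1 = Wall"
    and dec_2: "\<And>l. l < 3 \<Longrightarrow> dec (2 + l) = Live l q0 {0} {0} {0} 0"
    and code_0: "code_nth c 0 = m"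
    and code_Suc: "\<And>x y. x < m \<Longrightarrow> y < m \<Longrightarrow>
      code_nth c (Suc (prod_encode (x, y))) = enc (combine (dec x) (dec y))"
    and c: "0 < c"
begin

lemma old_state_less: "old_state c x < m"
  using m by (auto simp: old_state_def code_0 intro: order.strict_trans2[OF _ m])

lemma old_state_id: "x < m \<Longrightarrow> old_state c x = x"
  by (simp add: old_state_def code_0)

lemma old_state_eq_0: "old_state c x = 0 \<longleftrightarrow> x = 0"
  using m by (auto simp: old_state_def code_0)

abbreviation cell :: "nat \<Rightarrow> cell" where "cell x \<equiv> dec (old_state c x)"

lemma cell_eq_Blank: "cell x = Blank \<longleftrightarrow> x = 0"
  using dec(2)[OF old_state_less[of x]] dec(2)[of 0] m dec_0 old_state_eq_0[of x] by force

lemma extended_rule_table: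
  assumes "x \<noteq> 1 \<or> y \<noteq> 1" "x = 1 \<longrightarrow> y < m \<or> m + c \<le> Suc y" "y = 1 \<longrightarrow> x < m \<or> m + c \<le> Suc x"
  shows "extended_rule c x y = enc (combine (cell x) (cell y))"
  using assms code_Suc[OF old_state_less old_state_less]
  by (auto simp: extended_rule_def code_0)

lemma enc_combine:
  "enc (combine (cell x) (cell y)) < m" "cell (enc (combine (cell x) (cell y))) = combine (cell x) (cell y)"
  "enc (combine (cell x) (cell y)) \<noteq> 1"
proof -
  have *: "combine (cell x) (cell y) \<in> A"
    by (intro A dec old_state_less)
  then show "enc (combine (cell x) (cell y)) < m"
    "cell (enc (combine (cell x) (cell y))) = combine (cell x) (cell y)"
    by (simp_all add: enc old_state_id)
  show "enc (combine (cell x) (cell y)) \<noteq> 1"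
    using enc(2)[OF *] dec_1 combine_neq_Wall by metis
qed

lemma extended_rule_commute: "extended_rule c x y = extended_rule c y x"
proof -
  have "enc (combine (cell x) (cell y)) = enc (combine (cell y) (cell x))"
    by (simp add: combine_commute)
  then show ?thesis
    using m code_Suc[OF old_state_less old_state_less, of x y]
      code_Suc[OF old_state_less old_state_less, of y x]
    by (auto simp: extended_rule_def code_0)
qed

lemma extended_rule_less: "extended_rule c x y < m + c"
  using c enc_combine(1)[of x y] code_Suc[OF old_state_less old_state_less, of x y]
  by (auto simp: extended_rule_def code_0)

lemma extended_rule_neq_1: "extended_rule c x y \<noteq> 1"
  using m enc_combine(3)[of x y] code_Suc[OF old_state_less old_state_less, of x y]
  by (auto simp: extended_rule_def code_0)

lemma extension_instance: "extension c \<in> drs_instances" "symmetric_drs (extension c)"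
  using extended_rule_less m extended_rule_commute
  by (auto simp: drs_instances_def is_drs_def symmetric_drs_def extension_def code_0)

abbreviation dev :: "nat \<Rightarrow> nat \<Rightarrow> nat" where
  "dev i j \<equiv> development (extension c) (Suc i) (Suc j)"

lemma dev_0_0: "dev 0 0 = extended_rule c 1 1"
  and dev_0_Suc: "dev 0 (Suc j) = extended_rule c 1 (dev 0 j)"
  and dev_Suc_Suc: "dev (Suc i) (Suc j) = extended_rule c (dev i (Suc j)) (dev (Suc i) j)"
  by (simp_all add: extension_def)

lemma dev_neq_1: "dev i j \<noteq> 1"
  using extended_rule_neq_1 by (simp add: extension_def)

lemma dev_commute: "development (extension c) i j = development (extension c) j i"
proof (induction "extension c" i j rule: development.induct)
  case (1 j)
  then show ?case by (cases j) auto
next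
  case (3 i j)
  then show ?case using extended_rule_commute by (simp add: extension_def)
qed simp

text \<open>The chain counts to \<open>c\<close>. At its last state the table takes over with
  \<open>Wall\<close> as one neighbour, and \<open>extend\<close> appends two flagged cells whose
  sets become empty just where the thresholds reach the value \<open>c\<close> of register
  0.\<close>

lemma dev_first_row:
  "(if p < c then dev 0 p = m + p else dev 0 p < m) \<and>
   cell (dev 0 p) = (if p \<le> Suc c
      then Live (p mod 3) q0 {0} (if p < Suc c then {0} else {}) (if p < c then {0} else {})
        (if p < c then 0 else if p = c then 1 else 2)
      else Blank)"
proof -
  have new: "cell (m + p) = Live (p mod 3) q0 {0} {0} {0} 0" for p
    using dec_2[of "p mod 3"] by (simp add: old_state_def code_0)
  have cell_1: "cell 1 = Wall" using old_state_id[of 1] m dec_1 by simp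
  show ?thesis
  proof (induction p)
    case 0
    then show ?case
      using c new[of 0] dev_0_0 by (simp add: extended_rule_def code_0)
  next
    case (Suc p)
    show ?case
    proof (cases "Suc p < c")
      case True
      then have "dev 0 (Suc p) = m + Suc p"
        using Suc dev_0_Suc[of p] m by (simp add: extended_rule_def code_0)
      then show ?thesis using True new[of "Suc p"] by simp
    next
      case False
      have "dev 0 (Suc p) = enc (combine (cell 1) (cell (dev 0 p)))"
        unfolding dev_0_Suc
        by (rule extended_rule_table) (use dev_neq_1[of 0 p] Suc False m in \<open>auto split: if_splits\<close>)
      then have "dev 0 (Suc p) < m" "cell (dev 0 (Suc p)) = combine Wall (cell (dev 0 p))"
        using enc_combine(1,2)[of 1 "dev 0 p"] cell_1 by simp_all
      moreover have "Suc p mod 3 = Suc (p mod 3) mod 3" by presburger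
      ultimately show ?thesis using Suc False by auto
    qed
  qed
qed

sublocale ca_run q0 c "\<lambda>i j. cell (dev i j)"
proof
  show "cell (dev i j) = cell (dev j i)" for i j using dev_commute by metis
  show "cell (dev (Suc i) (Suc j)) = combine (cell (dev i (Suc j))) (cell (dev (Suc i) j))" for i j
    unfolding dev_Suc_Suc
    using extended_rule_table[of "dev i (Suc j)" "dev (Suc i) j"] dev_neq_1
      enc_combine(2)[of "dev i (Suc j)" "dev (Suc i) j"] by metis
qed (use q0 dev_first_row in auto)

lemma ultimately_zero_extension:
  "ultimately_zero (extension c) \<longleftrightarrow> (\<exists>t. fst ((step ^^ t) (q0, (\<lambda>_. 0)(0 := c))) = [])"
proof -
  have "ultimately_zero (extension c) \<longleftrightarrow> (\<exists>N. \<forall>i j. i + j > N \<longrightarrow> dev i j = 0)"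
  proof
    assume "ultimately_zero (extension c)"
    then obtain N where
      N: "\<And>i j. i > 0 \<Longrightarrow> j > 0 \<Longrightarrow> i + j > N \<Longrightarrow> development (extension c) i j = 0"
      by (auto simp: ultimately_zero_def extension_def)
    then have "dev i j = 0" if "i + j > N" for i j
      using that N[of "Suc i" "Suc j"] by simp
    then show "\<exists>N. \<forall>i j. i + j > N \<longrightarrow> dev i j = 0" by blast
  next
    assume "\<exists>N. \<forall>i j. i + j > N \<longrightarrow> dev i j = 0"
    then obtain N where N: "\<And>i j. i + j > N \<Longrightarrow> dev i j = 0" by blast
    \<comment> \<open>Cutting off the border lowers each index by 1, hence
      \<open>N + 2\<close>.\<close>
    have "development (extension c) i j = 0" if "i > 0" "j > 0" "i + j > N + 2" for i j
      using that N[of "i - 1" "j - 1"] by (simp del: development.simps)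
    moreover have "white (extension c) = 0" by (simp add: extension_def)
    ultimately show "ultimately_zero (extension c)"
      unfolding ultimately_zero_def by metis
  qed
  then show ?thesis using ultimately_Blank_iff_halts by (simp add: cell_eq_Blank del: development.simps)
qed

end

text \<open>Self-application: for any command \<open>a\<close>, the code \<open>c\<close> of the
  table of its own system is fed to \<open>a\<close> as input.\<close>

lemma program_instance:
  obtains c where "extension c \<in> drs_instances" "symmetric_drs (extension c)"
    "ultimately_zero (extension c) \<longleftrightarrow> (\<exists>t. fst ((step ^^ t) ([a], (\<lambda>_. 0)(0 := c))) = [])"
proof -
  define X where "X = conts a []"
  define R where "R = insert 0 ((\<lambda>q. case hd q of Inc r \<Rightarrow> r | _ \<Rightarrow> 0) ` X)"
  define A where "A = cells X R"
  have X: "next_stack q P \<in> X" if "q \<in> X" "next_stack q P \<noteq> []" for q P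
    using next_stack_conts[of q a "[]" P] that by (auto simp: X_def)
  have R: "r \<in> R" if "Inc r # K \<in> X" for r K
    using that by (force simp: R_def)
  have "finite X" "finite R" by (simp_all add: X_def R_def finite_conts)
  then have "finite A" by (simp add: A_def finite_cells)
  \<comment> \<open>Listing these cells first gives them the fixed numbers 0 to 4.\<close>
  define special where "special = Blank # Wall # map (\<lambda>l. Live l [a] {0} {0} {0} 0) [0, 1, 2]"
  obtain rest where rest: "set rest = A - set special" "distinct rest"
    using finite_distinct_list[of "A - set special"] \<open>finite A\<close> by auto
  define cs where "cs = special @ rest"
  have "[a] \<in> X" using Cons_in_conts by (simp add: X_def)
  then have "set special \<subseteq> A" by (auto simp: special_def A_def cells_def R_def)
  then have cs: "set cs = A" "distinct cs"
    using rest by (auto simp: cs_def) (simp add: special_def)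
  define m where "m = length cs"
  define dec where "dec = (\<lambda>i. cs ! i)"
  define enc where "enc = inv_into {..<m} dec"
  have bij: "bij_betw dec {..<m} A"
    unfolding dec_def m_def using cs bij_betw_nth[of cs "{..<length cs}" A] by blast
  define \<rho> where "\<rho> = (\<lambda>k. case prod_decode k of (x, y) \<Rightarrow> enc (combine (dec x) (dec y)))"
  \<comment> \<open>The table reaches all pairs of numbers below \<open>m\<close>, since
    \<open>prod_encode (x, y) = triangle (x + y) + x\<close>.\<close>
  define c where "c = list_encode (m # map \<rho> [0..<Suc (triangle (m + m) + m)])"
  have m: "5 \<le> m" by (simp add: m_def cs_def special_def)
  interpret extension_run "[a]" A dec enc m c
  proof
    show "combine x y \<in> A" if "x \<in> A" "y \<in> A" for x y
      using that X R unfolding A_def by (intro combine_in_cells) (auto simp: R_def)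
    show "dec i \<in> A" "enc (dec i) = i" if "i < m" for i
      using that bij by (auto simp: enc_def bij_betw_def intro: inv_into_f_f)
    show "enc x < m" "dec (enc x) = x" if "x \<in> A" for x
      using that bij inv_into_into[of x dec "{..<m}"] f_inv_into_f[of x dec "{..<m}"]
      by (auto simp: enc_def bij_betw_def)
    show "dec 0 = Blank" "dec 1 = Wall" by (simp_all add: dec_def cs_def special_def)
    show "dec (2 + l) = Live l [a] {0} {0} {0} 0" if "l < 3" for l
      using that by (auto simp: dec_def cs_def special_def less_Suc_eq numeral_3_eq_3)
    show "code_nth c 0 = m"
      unfolding c_def by (subst code_nth_list_encode) auto
    show "code_nth c (Suc (prod_encode (x, y))) = enc (combine (dec x) (dec y))"
      if "x < m" "y < m" for x y
    proof -
      have "prod_encode (x, y) \<le> triangle (m + m) + m"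
        using that triangle_mono[of "x + y" "m + m"] by (simp add: prod_encode_def)
      then have "code_nth c (Suc (prod_encode (x, y))) = \<rho> (prod_encode (x, y))"
        unfolding c_def by (subst code_nth_list_encode) (auto simp del: upt_Suc)
      then show ?thesis by (simp add: \<rho>_def)
    qed
    show "0 < c" by (simp add: c_def)
  qed (use m in auto)
  from extension_instance ultimately_zero_extension show thesis by (rule that)
qed

section \<open>The diagonal argument\<close>

lemma halted_forever:
  assumes "fst ((step ^^ t) cfg) = []"
  shows "fst ((step ^^ (t + k)) cfg) = []"
proof (induction k)
  case (Suc k)
  then show ?case by (simp add: step_def[of "(step ^^ (t + k)) cfg"])
qed (simp add: assms)

lemma symmetric_undecidable:
  "\<not> algorithmically_solvable drs_code {D \<in> drs_instances. symmetric_drs D} ultimately_zero"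
proof
  assume "algorithmically_solvable drs_code {D \<in> drs_instances. symmetric_drs D} ultimately_zero"
  then obtain p where p: "\<And>D. D \<in> drs_instances \<Longrightarrow> symmetric_drs D \<Longrightarrow>
      recf_eval p [drs_code D] (if ultimately_zero D then 1 else 0)"
    by (auto simp: algorithmically_solvable_def)
  obtain r where r: "\<And>c. recf_eval r [c] (drs_code (extension c))"
    using computable_drs_code_extension unfolding computable_def
    by (metis One_nat_def length_Cons list.size(3) nth_Cons_0)
  \<comment> \<open>Input in register 0, answer in register 1, scratch space from register 2
    on.\<close>
  from implementableD[OF implementable, of "[0]" 2 1 "Comp p [r]"]
  obtain a where a: "\<And>y s. recf_eval (Comp p [r]) [s 0] y \<Longrightarrow> \<forall>r\<ge>2. s r = 0 \<Longrightarrow>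
      exec a s (s(1 := y))"
    by auto
  \<comment> \<open>Diverges on the answer 1 and halts on the answer 0, contrary to what the answer
    asserts about the system of \<open>prog\<close>.\<close>
  define prog where "prog = Seq a (While 1 Skip)"
  obtain c where c: "extension c \<in> drs_instances" "symmetric_drs (extension c)"
    "ultimately_zero (extension c) \<longleftrightarrow> (\<exists>t. fst ((step ^^ t) ([prog], (\<lambda>_. 0)(0 := c))) = [])"
    by (rule program_instance)
  define y :: nat where "y = (if ultimately_zero (extension c) then 1 else 0)"
  let ?s = "(\<lambda>_. 0)(0 := c)"
  have "recf_eval (Comp p [r]) [c] y"
    using r p[OF c(1,2)] by (auto simp: y_def intro!: recf_eval.Comp[where ys = "[drs_code (extension c)]"])
  then have ex: "exec a ?s (?s(1 := y))" by (intro a) auto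
  show False
  proof (cases "ultimately_zero (extension c)")
    case False
    then have "exec prog ?s (?s(1 := y))"
      unfolding prog_def by (intro exec_Seq[OF ex] exec_While_0) (simp add: y_def)
    then have "\<exists>t. (step ^^ t) ([prog], ?s) = ([], ?s(1 := y))" by (simp add: exec_def)
    then show False using False c(3) by (metis fst_conv)
  next
    case True
    let ?loop = "([While 1 Skip], ?s(1 := y))"
    obtain u where "(step ^^ u) ([a, While 1 Skip], ?s) = ?loop"
      using ex unfolding exec_def by blast
    then have u: "(step ^^ Suc u) ([prog], ?s) = ?loop"
      by (simp add: funpow_swap1 step_def prog_def)
    obtain t where t: "fst ((step ^^ t) ([prog], ?s)) = []" using True c(3) by blast
    have loop: "(step ^^ k) ?loop \<in> {?loop, ([Skip, While 1 Skip], ?s(1 := y))}" for k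
    proof (induction k)
      case (Suc k)
      then show ?case using True by (auto simp: step_def y_def)
    qed simp
    \<comment> \<open>Adding the \<open>Suc u\<close> steps that lead into the loop turns the
      halting time into a number of steps within the loop.\<close>
    from t have "fst ((step ^^ (t + Suc u)) ([prog], ?s)) = []"
      by (rule halted_forever)
    then have "fst ((step ^^ t) ?loop) = []" unfolding funpow_add comp_apply u .
    then show False using loop[of t] by auto
  qed
qed

theorem theorem1p4:
  "\<not> algorithmically_solvable drs_code drs_instances ultimately_zero \<and>
   \<not> algorithmically_solvable drs_code {D \<in> drs_instances. symmetric_drs D} ultimately_zero"
proof -
  \<comment> \<open>A solver for all instances also solves the symmetric ones.\<close>
  have "algorithmically_solvable drs_code {D \<in> drs_instances. symmetric_drs D} ultimately_zero"
    if "algorithmically_solvable drs_code drs_instances ultimately_zero"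
    using that unfolding algorithmically_solvable_def by blast
  then show ?thesis using symmetric_undecidable by blast
qed

end
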